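(* Let $\Sigma$ be a $C^1$ smooth embedded submanifold of a homogeneous group $\mathbb G$ such that $T_p\Sigma\subset H_p\mathbb G$ for every $p\in\Sigma$. Then $\Sigma$ is a horizontal submanifold.
   Context: A homogeneous group is a finite dimensional real vector space $\mathbb G=H^1\oplus\cdots\oplus H^\iota$, $H^\iota\neq\{0\}$, with a nilpotent Lie bracket satisfying $[H^i,H^j]\subset H^{i+j}$ ($H^k=\{0\}$ for $k>\iota$), with group law given by the Baker-Campbell-Hausdorff formula $xy=x+y+\frac12[x,y]+\cdots$ (so the identity is $0$ and $x^{-1}=-x$), and with the linear dilations $\delta_r$, $r>0$, $\delta_r x=r^ix$ for $x\in H^i$. Put $q=\dim\mathbb G$, $h_j=\dim H^j$, $m_j=h_1+\cdots+h_j$, $m_0=0$. $\mathrm{Lie}(\mathbb G)$ is the Lie algebra of left invariant vector fields; $\mathbb G$ is identified with $T_0\mathbb G$, and then $\exp X=X(0)$. A scalar product on $\mathbb G$ making the $H^j$ mutually orthogonal is fixed. The horizontal fiber at $p$ is $H_p\mathbb G=\{X(p):X\in\mathrm{Lie}(\mathbb G),\ X(0)\in H^1\}\subset T_p\mathbb G$. Fix an orthonormal basis $(e_1,\dots,e_q)$ such that $(e_i)_{m_{j-1}<i\le m_j}$ is a basis of $H^j$ for each $j$; let $X_i\in\mathrm{Lie}(\mathbb G)$ with $X_i(0)=e_i$, and $d_i=j$ if $m_{j-1}<i\le m_j$. For $I=(i_1<\cdots<i_k)$ put $X_I=X_{i_1}\wedge\cdots\wedge X_{i_k}$, $d(X_I)=d_{i_1}+\cdots+d_{i_k}$,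 and $\pi_M(\sum_I c_IX_I)=\sum_{d(X_I)=M}c_IX_I$. Let $n=\dim\Sigma$. For $p\in\Sigma$ let $\xi$ be the left invariant $n$-vector field with $\xi(p)=t_1\wedge\cdots\wedge t_n$, $(t_i)$ a basis of $T_p\Sigma$; let $d_\Sigma(p)=\max\{M:\pi_M(\xi)\neq0\}$, and with $M=d_\Sigma(p)$ let $\mathcal A_p\Sigma=\{X\in\mathrm{Lie}(\mathbb G):X\wedge\pi_M(\xi)=0\}$ and $A_p\Sigma=\exp\mathcal A_p\Sigma$. The point $p$ is algebraically regular if $\mathcal A_p\Sigma$ is a Lie subalgebra. It is horizontal if it is algebraically regular and $A_p\Sigma$ is a horizontal subgroup, that is, a Lie subgroup of $\mathbb G$ which is a linear subspace contained in $H^1$. $\Sigma$ is a horizontal submanifold if all of its points are horizontal. *)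

theory Defs
  imports "HOL-Analysis.Analysis"
begin

section \<open>Embedded \<open>C\<^sup>1\<close> submanifolds\<close>

definition C1_on :: "'a::real_normed_vector set \<Rightarrow> ('a \<Rightarrow> 'b::real_normed_vector) \<Rightarrow> bool" where
  "C1_on U f \<longleftrightarrow>
     (\<exists>f'. (\<forall>x\<in>U. (f has_derivative blinfun_apply (f' x)) (at x)) \<and> continuous_on U f')"

text \<open>Slice charts. The model space \<open>\<real>\<^sup>n\<close> is an \<open>n\<close>-dimensional linear subspace \<open>L\<close> of the
  ambient space, so that \<open>n\<close> can be a natural number.\<close>

definition embedded_C1_submanifold :: "nat \<Rightarrow> 'a::euclidean_space set \<Rightarrow> bool" where
  "embedded_C1_submanifold n S \<longleftrightarrow>
     (\<forall>p\<in>S. \<exists>(U :: 'a set) (V :: 'a set) \<phi> \<psi> L. open U \<and> open V \<and> p \<in> U \<and>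
        homeomorphism U V \<phi> \<psi> \<and> C1_on U \<phi> \<and> C1_on V \<psi> \<and> subspace L \<and> dim L = n \<and> \<phi> ` (S \<inter> U) = V \<inter> L)"

definition tangent_space :: "'a::euclidean_space set \<Rightarrow> 'a \<Rightarrow> 'a set" where
  "tangent_space S p =
     {v. \<exists>\<gamma> \<epsilon>. \<epsilon> > (0::real) \<and> C1_on {-\<epsilon><..<\<epsilon>} \<gamma> \<and> \<gamma> ` {-\<epsilon><..<\<epsilon>} \<subseteq> S \<and> \<gamma> 0 = p \<and>
            (\<gamma> has_vector_derivative v) (at 0)}"


section \<open>The exterior algebra on generators indexed by natural numbers\<close>

text \<open>A multivector \<open>\<Sum>\<^sub>I a\<^sub>I b\<^sub>I\<close>, with \<open>b\<^sub>I = b\<^bsub>i\<^sub>1\<^esub> \<and> \<dots> \<and> b\<^bsub>i\<^sub>k\<^esub>\<close> for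
  \<open>I = {i\<^sub>1 < \<dots> < i\<^sub>k}\<close>, is represented by its coefficients \<open>I \<mapsto> a\<^sub>I\<close>. The product is determined by
  \<open>b\<^sub>I \<and> b\<^sub>J = \<plusminus> b\<^bsub>I \<union> J\<^esub>\<close> for disjoint \<open>I, J\<close> (the sign is that of the permutation sorting the
  concatenation of \<open>I\<close> and \<open>J\<close>), and \<open>b\<^sub>I \<and> b\<^sub>J = 0\<close> otherwise.\<close>

type_synonym multivector = "nat set \<Rightarrow> real"

definition shuffle_sign :: "nat set \<Rightarrow> nat set \<Rightarrow> real" where
  "shuffle_sign I J = (- 1) ^ card {(i, j). i \<in> I \<and> j \<in> J \<and> j < i}"

definition wedge :: "multivector \<Rightarrow> multivector \<Rightarrow> multivector" where
  "wedge a b = (\<lambda>K. \<Sum>I\<in>Pow K. shuffle_sign I (K - I) * a I * b (K - I))"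

definition mv_one :: multivector where
  "mv_one = (\<lambda>I. if I = {} then 1 else 0)"


section \<open>Homogeneous groups\<close>

text \<open>The inner product of \<open>'a\<close> is the fixed scalar product. Orthogonality makes the sum of the
  layers direct, and the grading makes the bracket nilpotent.\<close>

locale homogeneous_group =
  fixes H :: "nat \<Rightarrow> 'a::euclidean_space set"
    and \<iota> :: nat
    and br :: "'a \<Rightarrow> 'a \<Rightarrow> 'a"
  assumes layer_subspace: "\<And>i. 1 \<le> i \<Longrightarrow> subspace (H i)"
    and layers_span: "span (\<Union>i\<in>{1..\<iota>}. H i) = UNIV"
    and layers_orthogonal:
      "\<And>i j x y. \<lbrakk>1 \<le> i; 1 \<le> j; i \<noteq> j; x \<in> H i; y \<in> H j\<rbrakk> \<Longrightarrow> x \<bullet> y = 0"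
    and step_pos: "1 \<le> \<iota>"
    and top_layer: "H \<iota> \<noteq> {0}"
    and layers_above: "\<And>k. \<iota> < k \<Longrightarrow> H k = {0}"
    and br_bilinear: "bilinear br"
    and br_alternating: "\<And>x. br x x = 0"
    and br_jacobi: "\<And>x y z. br x (br y z) + br y (br z x) + br z (br x y) = 0"
    and br_layers: "\<And>i j x y. \<lbrakk>1 \<le> i; 1 \<le> j; x \<in> H i; y \<in> H j\<rbrakk> \<Longrightarrow> br x y \<in> H (i + j)"
begin

text \<open>\<open>nested_br [x\<^sub>1, \<dots>, x\<^sub>n] = [x\<^sub>1, [x\<^sub>2, \<dots> [x\<^bsub>n-1\<^esub>, x\<^sub>n] \<dots> ]]\<close>\<close>

fun nested_br :: "'a list \<Rightarrow> 'a" where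
  "nested_br [] = 0"
| "nested_br [x] = x"
| "nested_br (x # y # zs) = br x (nested_br (y # zs))"

text \<open>The Baker-Campbell-Hausdorff series in Dynkin's form: the part of total degree \<open>N\<close> of
  \<open>\<Sum>\<^bsub>k \<ge> 1\<^esub> (-1)\<^bsup>k-1\<^esup>/k \<Sum> [x\<^bsup>r\<^sub>1\<^esup> y\<^bsup>s\<^sub>1\<^esup> \<dots> x\<^bsup>r\<^sub>k\<^esup> y\<^bsup>s\<^sub>k\<^esup>] / ((\<Sum>\<^sub>i r\<^sub>i + s\<^sub>i) \<Prod>\<^sub>i r\<^sub>i! s\<^sub>i!)\<close>,
  the inner sum being over \<open>r\<^sub>i + s\<^sub>i > 0\<close>. Degrees above \<open>\<iota>\<close> vanish by nilpotency.\<close>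

definition bch_index :: "nat \<Rightarrow> nat \<Rightarrow> (nat \<times> nat) list set" where
  "bch_index N k = {rs. length rs = k \<and> (\<forall>(r, s)\<in>set rs. 0 < r + s) \<and> (\<Sum>(r, s)\<leftarrow>rs. r + s) = N}"

definition bch_word :: "'a \<Rightarrow> 'a \<Rightarrow> (nat \<times> nat) list \<Rightarrow> 'a list" where
  "bch_word x y rs = concat (map (\<lambda>(r, s). replicate r x @ replicate s y) rs)"

definition bch_term :: "nat \<Rightarrow> 'a \<Rightarrow> 'a \<Rightarrow> 'a" where
  "bch_term N x y =
     (\<Sum>k=1..N. ((- 1) ^ (k - 1) / real k) *\<^sub>R
        (\<Sum>rs\<in>bch_index N k.
           (1 / (real N * (\<Prod>(r, s)\<leftarrow>rs. fact r * fact s))) *\<^sub>R nested_br (bch_word x y rs)))"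

definition mult :: "'a \<Rightarrow> 'a \<Rightarrow> 'a" where
  "mult x y = (\<Sum>N=1..\<iota>. bch_term N x y)"

text \<open>Each tangent space of the vector space \<open>'a\<close> is identified with \<open>'a\<close>, so a vector field is
  a map \<open>'a \<Rightarrow> 'a\<close>. Left invariant fields are automatically smooth.\<close>

definition Lie :: "('a \<Rightarrow> 'a) set" where
  "Lie = {X. \<forall>p x. X (mult p x) = frechet_derivative (mult p) (at x) (X x)}"

definition vf_bracket :: "('a \<Rightarrow> 'a) \<Rightarrow> ('a \<Rightarrow> 'a) \<Rightarrow> 'a \<Rightarrow> 'a" where
  "vf_bracket X Y p = frechet_derivative Y (at p) (X p) - frechet_derivative X (at p) (Y p)"

definition lie_subalgebra :: "('a \<Rightarrow> 'a) set \<Rightarrow> bool" where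
  "lie_subalgebra A \<longleftrightarrow>
     A \<subseteq> Lie \<and> (\<lambda>p. 0) \<in> A \<and>
     (\<forall>X\<in>A. \<forall>Y\<in>A. (\<lambda>p. X p + Y p) \<in> A) \<and>
     (\<forall>c. \<forall>X\<in>A. (\<lambda>p. c *\<^sub>R X p) \<in> A) \<and>
     (\<forall>X\<in>A. \<forall>Y\<in>A. vf_bracket X Y \<in> A)"

text \<open>The exponential map under the identification of the group with its tangent space at \<open>0\<close>.\<close>

definition lie_exp :: "('a \<Rightarrow> 'a) \<Rightarrow> 'a" where
  "lie_exp X = X 0"

definition horizontal_fiber :: "'a \<Rightarrow> 'a set" where
  "horizontal_fiber p = {X p |X. X \<in> Lie \<and> X 0 \<in> H 1}"

text \<open>The identity of the group is \<open>0\<close> and the inverse of \<open>x\<close> is \<open>-x\<close>.\<close>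

definition is_subgroup :: "'a set \<Rightarrow> bool" where
  "is_subgroup A \<longleftrightarrow> 0 \<in> A \<and> (\<forall>x\<in>A. \<forall>y\<in>A. mult x y \<in> A) \<and> (\<forall>x\<in>A. - x \<in> A)"

text \<open>A subgroup that is a linear subspace is closed and an embedded smooth submanifold with
  polynomial operations, hence a Lie subgroup.\<close>

definition horizontal_subgroup :: "'a set \<Rightarrow> bool" where
  "horizontal_subgroup A \<longleftrightarrow> is_subgroup A \<and> subspace A \<and> A \<subseteq> H 1"

definition m :: "nat \<Rightarrow> nat" where
  "m j = (\<Sum>i=1..j. dim (H i))"

end


section \<open>Degrees of tangent multivectors\<close>

locale graded_basis = homogeneous_group H \<iota> br
  for H :: "nat \<Rightarrow> 'a::euclidean_space set" and \<iota> br +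
  fixes e :: "nat \<Rightarrow> 'a"
  assumes e_orthonormal:
      "\<And>i j. \<lbrakk>i \<in> {1..DIM('a)}; j \<in> {1..DIM('a)}\<rbrakk> \<Longrightarrow> e i \<bullet> e j = (if i = j then 1 else 0)"
    and e_layer: "\<And>j. j \<in> {1..\<iota>} \<Longrightarrow> span (e ` {m (j - 1)<..m j}) = H j"
begin

definition deg :: "nat \<Rightarrow> nat" where
  "deg i = (THE j. m (j - 1) < i \<and> i \<le> m j)"

definition deg_set :: "nat set \<Rightarrow> nat" where
  "deg_set I = (\<Sum>i\<in>I. deg i)"

text \<open>The left invariant field with value \<open>e\<^sub>i\<close> at \<open>0\<close>.\<close>

definition frame :: "nat \<Rightarrow> 'a \<Rightarrow> 'a" where
  "frame i p = frechet_derivative (mult p) (at 0) (e i)"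

text \<open>Multivectors at a point are expanded in the basis \<open>e\<^sub>I\<close>; \<open>wedge_vecs [v\<^sub>1, \<dots>, v\<^sub>k]\<close> is
  \<open>v\<^sub>1 \<and> \<dots> \<and> v\<^sub>k\<close>.\<close>

definition mv_vec :: "'a \<Rightarrow> multivector" where
  "mv_vec v = (\<lambda>I. if \<exists>i\<in>{1..DIM('a)}. I = {i} then v \<bullet> e (the_elem I) else 0)"

definition wedge_vecs :: "'a list \<Rightarrow> multivector" where
  "wedge_vecs vs = foldr (\<lambda>v a. wedge (mv_vec v) a) vs mv_one"

definition frame_wedge :: "nat set \<Rightarrow> 'a \<Rightarrow> multivector" where
  "frame_wedge I p = wedge_vecs (map (\<lambda>i. frame i p) (sorted_list_of_set I))"

text \<open>A left invariant \<open>k\<close>-vector field \<open>\<Sum>\<^sub>I c\<^sub>I X\<^sub>I\<close>, where \<open>X\<^sub>I\<close> is \<open>frame_wedge I\<close>, is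
  represented by its constant coefficients \<open>c\<close>; \<open>mv_field c p\<close> is its value at \<open>p\<close>, expanded
  in the basis \<open>e\<^sub>I\<close>.\<close>

definition left_inv_mv :: "nat \<Rightarrow> multivector set" where
  "left_inv_mv k = {c. \<forall>I. c I \<noteq> 0 \<longrightarrow> I \<subseteq> {1..DIM('a)} \<and> card I = k}"

definition mv_field :: "multivector \<Rightarrow> 'a \<Rightarrow> multivector" where
  "mv_field c p = (\<lambda>K. \<Sum>I\<in>Pow {1..DIM('a)}. c I * frame_wedge I p K)"

definition mv_proj :: "nat \<Rightarrow> multivector \<Rightarrow> multivector" where
  "mv_proj M c = (\<lambda>I. if deg_set I = M then c I else 0)"

text \<open>A left invariant \<open>n\<close>-vector field with value \<open>t\<^sub>1 \<and> \<dots> \<and> t\<^sub>n\<close> at \<open>p\<close>, for some basis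
  \<open>t\<^sub>1, \<dots>, t\<^sub>n\<close> of the tangent space. It is determined up to a nonzero factor, on which nothing
  below depends.\<close>

definition tangent_mv :: "nat \<Rightarrow> 'a set \<Rightarrow> 'a \<Rightarrow> multivector" where
  "tangent_mv n S p =
     (SOME \<xi>. \<xi> \<in> left_inv_mv n \<and>
        (\<exists>ts. length ts = n \<and> distinct ts \<and> independent (set ts) \<and>
              span (set ts) = tangent_space S p \<and> mv_field \<xi> p = wedge_vecs ts))"

definition point_degree :: "nat \<Rightarrow> 'a set \<Rightarrow> 'a \<Rightarrow> nat" where
  "point_degree n S p = Max {M. mv_proj M (tangent_mv n S p) \<noteq> (\<lambda>I. 0)}"

definition tangent_algebra :: "nat \<Rightarrow> 'a set \<Rightarrow> 'a \<Rightarrow> ('a \<Rightarrow> 'a) set" where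
  "tangent_algebra n S p =
     {X \<in> Lie. \<forall>x. wedge (mv_vec (X x))
        (mv_field (mv_proj (point_degree n S p) (tangent_mv n S p)) x) = (\<lambda>I. 0)}"

definition tangent_set :: "nat \<Rightarrow> 'a set \<Rightarrow> 'a \<Rightarrow> 'a set" where
  "tangent_set n S p = lie_exp ` tangent_algebra n S p"

definition algebraically_regular :: "nat \<Rightarrow> 'a set \<Rightarrow> 'a \<Rightarrow> bool" where
  "algebraically_regular n S p \<longleftrightarrow> lie_subalgebra (tangent_algebra n S p)"

definition horizontal_point :: "nat \<Rightarrow> 'a set \<Rightarrow> 'a \<Rightarrow> bool" where
  "horizontal_point n S p \<longleftrightarrow>
     algebraically_regular n S p \<and> horizontal_subgroup (tangent_set n S p)"

definition horizontal_submanifold :: "nat \<Rightarrow> 'a set \<Rightarrow> bool" where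
  "horizontal_submanifold n S \<longleftrightarrow> (\<forall>p\<in>S. horizontal_point n S p)"

end

end

(* Let F_p be the differential at 0 of the left translation by p, and let V be the set of
   v in H^1 with F_p v tangent to S at p. By hypothesis T_p S = F_p V. In a C^1 parametrization
   psi of S the second layer of psi satisfies d psi_2 = 1/2 [psi_1, d psi_1], and equality of mixed
   second derivatives at p forces [V, V] = 0. The tangent n-vector is, up to a factor, the wedge of
   a basis of V, so it has pure degree n and the tangent algebra consists of the left invariant
   fields with value in V at 0. Commuting vectors of H^1 multiply by addition and their fields have
   zero bracket, so V is a horizontal subgroup. *)
theory Submission
  imports Defs
begin

text \<open>The obstacle is regularity: \<open>\<psi>\<close> is only C^1, so the equation for d
  psi_2, whose right side contains d psi_1, cannot simply be differentiated, and the usual theorem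
  on second derivatives does not apply to psi_2. The remedy has two halves. Subtracting the linear
  expression 1/2 [p_1, psi_1] leaves a function whose first derivatives are 1/2
  [psi_1 - p_1, d psi_1]: a differentiable factor that vanishes at the base point times a continuous
  one, hence differentiable at that one point. Equality of mixed partials is then proved under
  exactly this hypothesis, differentiability of the first partials at a single point. Layers above
  the second are never computed. [V, V] lies in H^2, and the remaining terms of the product are only
  located in the span of the layers from the third on, which is orthogonal to H^2. Two conditions
  range over all points: membership in the tangent algebra and the value of the bracket of fields.
  Both reduce to the point 0. F_x extends to a multiplicative map of the exterior algebra, and the
  bracket of left invariant fields is left invariant because the second derivative of the polynomial
  map \<open>mult p\<close> is symmetric.\<close>

section \<open>Symmetry of second derivatives\<close>

text \<open>Symmetry is carried through the structural induction: in the product case the cross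
  terms \<open>f' x u * g' x v\<close> and \<open>f' x v * g' x u\<close> change places.\<close>

lemma real_polynomial_second_derivative:
  assumes "real_polynomial_function f"
  shows "\<exists>f' f''. (\<forall>x. (f has_derivative f' x) (at x)) \<and>
    (\<forall>x v. ((\<lambda>y. f' y v) has_derivative (\<lambda>u. f'' x u v)) (at x)) \<and>
    (\<forall>x u v. f'' x u v = f'' x v u)"
  using assms
proof (induction f rule: real_polynomial_function.induct)
  case (linear f)
  then show ?case
    by (intro exI[of _ "\<lambda>x. f"] exI[of _ "\<lambda>x u v. 0"])
       (auto intro: bounded_linear_imp_has_derivative)
next
  case (const c)
  then show ?case
    by (intro exI[of _ "\<lambda>x u. 0"] exI[of _ "\<lambda>x u v. 0"]) auto
next
  case (add f g)
  then obtain f' f'' g' g'' where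
    "\<And>x. (f has_derivative f' x) (at x)"
    "\<And>x v. ((\<lambda>y. f' y v) has_derivative (\<lambda>u. f'' x u v)) (at x)"
    "\<And>x u v. f'' x u v = f'' x v u"
    "\<And>x. (g has_derivative g' x) (at x)"
    "\<And>x v. ((\<lambda>y. g' y v) has_derivative (\<lambda>u. g'' x u v)) (at x)"
    "\<And>x u v. g'' x u v = g'' x v u"
    by blast
  then show ?case
    by (intro exI[of _ "\<lambda>x u. f' x u + g' x u"] exI[of _ "\<lambda>x u v. f'' x u v + g'' x u v"]
        conjI allI has_derivative_add arg_cong2[of _ _ _ _ "(+)"])
next
  case (mult f g)
  then obtain f' f'' g' g'' where *:
    "\<And>x. (f has_derivative f' x) (at x)"
    "\<And>x v. ((\<lambda>y. f' y v) has_derivative (\<lambda>u. f'' x u v)) (at x)"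
    "\<And>x u v. f'' x u v = f'' x v u"
    "\<And>x. (g has_derivative g' x) (at x)"
    "\<And>x v. ((\<lambda>y. g' y v) has_derivative (\<lambda>u. g'' x u v)) (at x)"
    "\<And>x u v. g'' x u v = g'' x v u"
    by blast
  let ?h' = "\<lambda>x v. f x * g' x v + f' x v * g x"
  let ?h'' = "\<lambda>x u v. (f x * g'' x u v + f' x u * g' x v) + (f' x v * g' x u + f'' x u v * g x)"
  have "((\<lambda>y. f y * g y) has_derivative ?h' x) (at x)" for x
    by (rule has_derivative_mult[OF *(1,4)])
  moreover have "((\<lambda>y. ?h' y v) has_derivative (\<lambda>u. ?h'' x u v)) (at x)" for x v
    by (rule has_derivative_add[OF has_derivative_mult[OF *(1,5)] has_derivative_mult[OF *(2,4)]])
  moreover have "?h'' x u v = ?h'' x v u" for x u v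
    using *(3)[of x u v] *(6)[of x u v] by simp
  ultimately show ?case
    by (intro exI[of _ ?h'] exI[of _ ?h''] conjI allI)
qed

lemma polynomial_second_derivative:
  fixes f :: "'a::real_normed_vector \<Rightarrow> 'b::euclidean_space"
  assumes f: "polynomial_function f"
  obtains f'' where
    "\<And>x. (f has_derivative frechet_derivative f (at x)) (at x)"
    "\<And>x v. ((\<lambda>y. frechet_derivative f (at y) v) has_derivative (\<lambda>u. f'' x u v)) (at x)"
    "\<And>x u v. f'' x u v = f'' x v u"
proof -
  have "\<forall>b. \<exists>g' g''. (\<forall>x. ((\<lambda>y. f y \<bullet> b) has_derivative g' x) (at x)) \<and>
    (\<forall>x v. ((\<lambda>y. g' y v) has_derivative (\<lambda>u. g'' x u v)) (at x)) \<and>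
    (\<forall>x u v. g'' x u v = g'' x v u)"
  proof (intro allI real_polynomial_second_derivative)
    fix b :: 'b
    have "real_polynomial_function ((\<lambda>z. z \<bullet> b) \<circ> f)"
      using f bounded_linear_inner_left unfolding polynomial_function_def by blast
    then show "real_polynomial_function (\<lambda>y. f y \<bullet> b)"
      by (simp add: o_def)
  qed
  from choice[OF this] obtain g' where
    "\<forall>b. \<exists>g''. (\<forall>x. ((\<lambda>y. f y \<bullet> b) has_derivative g' b x) (at x)) \<and>
    (\<forall>x v. ((\<lambda>y. g' b y v) has_derivative (\<lambda>u. g'' x u v)) (at x)) \<and>
    (\<forall>x u v. g'' x u v = g'' x v u)" ..
  from choice[OF this] obtain g'' where g:
    "\<And>b x. ((\<lambda>y. f y \<bullet> b) has_derivative g' b x) (at x)"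
    "\<And>b x v. ((\<lambda>y. g' b y v) has_derivative (\<lambda>u. g'' b x u v)) (at x)"
    "\<And>b x u v. g'' b x u v = g'' b x v u"
    by blast
  let ?f' = "\<lambda>x v. \<Sum>b\<in>Basis. g' b x v *\<^sub>R b"
  let ?f'' = "\<lambda>x u v. \<Sum>b\<in>Basis. g'' b x u v *\<^sub>R b"
  have "(f has_derivative ?f' x) (at x)" for x
  proof -
    have "((\<lambda>y. \<Sum>b\<in>Basis. (f y \<bullet> b) *\<^sub>R b) has_derivative ?f' x) (at x)"
      by (intro has_derivative_sum has_derivative_scaleR_left g)
    then show ?thesis
      by (simp add: euclidean_representation)
  qed
  note f' = this
  have eq: "frechet_derivative f (at x) = ?f' x" for x
    using frechet_derivative_at[OF f'] by simp
  have "((\<lambda>y. ?f' y v) has_derivative (\<lambda>u. ?f'' x u v)) (at x)" for x v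
    by (intro has_derivative_sum has_derivative_scaleR_left g)
  moreover have "?f'' x u v = ?f'' x v u" for x u v
    by (intro sum.cong) (simp_all add: g(3)[of _ x u v])
  ultimately show ?thesis
    using that[of ?f''] f' by (simp add: eq)
qed

text \<open>Product rule for a derivative applied to a moving vector. The derivative of
  \<open>f\<close> is known to be differentiable only on each fixed vector, so \<open>Y y\<close> is
  expanded in a basis. Reassembling the sum takes linearity of \<open>f'' u\<close>, which symmetry
  transfers from the other slot.\<close>

lemma has_derivative_frechet_derivative_apply:
  fixes f :: "'a::euclidean_space \<Rightarrow> 'b::euclidean_space" and Y :: "'a \<Rightarrow> 'a"
  assumes f: "(f has_derivative frechet_derivative f (at x)) (at x)"
    and f'': "\<And>v. ((\<lambda>y. frechet_derivative f (at y) v) has_derivative (\<lambda>u. f'' u v)) (at x)"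
    and lin: "\<And>y. linear (frechet_derivative f (at y))"
    and sym: "\<And>u v. f'' u v = f'' v u"
    and Y: "(Y has_derivative Y') (at x)"
  shows "((\<lambda>y. frechet_derivative f (at y) (Y y)) has_derivative
           (\<lambda>u. f'' u (Y x) + frechet_derivative f (at x) (Y' u))) (at x)"
proof -
  have lin'': "linear (f'' u)" for u
  proof -
    have "(\<lambda>v. f'' v u) = f'' u"
      using sym by blast
    then show ?thesis
      using has_derivative_linear[OF f''[of u]] by simp
  qed
  have expand: "F v = (\<Sum>b\<in>Basis. (v \<bullet> b) *\<^sub>R F b)" if "linear F" for F :: "'a \<Rightarrow> 'b" and v
  proof -
    have "F v = F (\<Sum>b\<in>Basis. (v \<bullet> b) *\<^sub>R b)"
      by (simp add: euclidean_representation)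
    also have "\<dots> = (\<Sum>b\<in>Basis. (v \<bullet> b) *\<^sub>R F b)"
      using that by (simp add: linear_sum linear_scale)
    finally show ?thesis .
  qed
  have "((\<lambda>y. \<Sum>b\<in>Basis. (Y y \<bullet> b) *\<^sub>R frechet_derivative f (at y) b) has_derivative
      (\<lambda>u. \<Sum>b\<in>Basis. (Y x \<bullet> b) *\<^sub>R f'' u b + (Y' u \<bullet> b) *\<^sub>R frechet_derivative f (at x) b)) (at x)"
    by (intro has_derivative_sum has_derivative_scaleR has_derivative_inner_left Y f'')
  moreover have "(\<lambda>y. \<Sum>b\<in>Basis. (Y y \<bullet> b) *\<^sub>R frechet_derivative f (at y) b)
      = (\<lambda>y. frechet_derivative f (at y) (Y y))"
    by (intro ext expand[OF lin, symmetric])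
  moreover have "(\<Sum>b\<in>Basis. (Y x \<bullet> b) *\<^sub>R f'' u b + (Y' u \<bullet> b) *\<^sub>R frechet_derivative f (at x) b)
      = f'' u (Y x) + frechet_derivative f (at x) (Y' u)" for u
    unfolding sum.distrib
    by (intro arg_cong2[of _ _ _ _ "(+)"] expand[symmetric] lin lin'')
  ultimately show ?thesis
    by simp
qed

text \<open>\<open>p\<close> is differentiable at the origin only. One application of the mean value
  theorem in \<open>s\<close> expresses the second difference through values of \<open>p\<close>,
  and the first order expansion of \<open>p\<close> at the origin does the rest.\<close>

lemma second_difference_limit:
  fixes h p :: "real \<Rightarrow> real \<Rightarrow> real"
  assumes "0 < r" "0 < \<epsilon>"
    and der: "\<And>s t. \<lbrakk>\<bar>s\<bar> < r; \<bar>t\<bar> < r\<rbrakk> \<Longrightarrow> ((\<lambda>s. h s t) has_real_derivative p s t) (at s)"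
    and p: "((\<lambda>z. p (fst z) (snd z)) has_derivative p') (at (0, 0))"
  shows "\<exists>\<delta>>0. \<forall>t. 0 < t \<longrightarrow> t < \<delta> \<longrightarrow>
    \<bar>(h t t - h t 0 - h 0 t + h 0 0) - t\<^sup>2 * p' (0, 1)\<bar> \<le> \<epsilon> * t\<^sup>2"
proof -
  \<comment> \<open>The points \<open>(\<sigma>, t)\<close> and \<open>(\<sigma>, 0)\<close> have
    norm at most \<open>2 * t\<close> and \<open>t\<close>, so the two errors add up to
    \<open>3 * t\<close> times this tolerance.\<close>
  have "0 < \<epsilon> / 3"
    using \<open>0 < \<epsilon>\<close> by simp
  from p[unfolded has_derivative_at_alt, THEN conjunct2, rule_format, OF this] obtain \<delta> where \<delta>: "\<delta> > 0" and
    app': "\<forall>z. norm (z - (0, 0)) < \<delta> \<longrightarrow>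
      norm (p (fst z) (snd z) - p (fst (0::real, 0::real)) (snd (0::real, 0::real)) - p' (z - (0, 0))) \<le> \<epsilon> / 3 * norm (z - (0, 0))"
    by blast
  have app: "norm (p s t - p 0 0 - p' (s, t)) \<le> \<epsilon> / 3 * norm (s, t)" if "norm (s, t) < \<delta>" for s t
    using app'[rule_format, of "(s, t)"] that by simp
  interpret p': bounded_linear p'
    using p by (rule has_derivative_bounded_linear)
  have "\<bar>(h t t - h t 0 - h 0 t + h 0 0) - t\<^sup>2 * p' (0, 1)\<bar> \<le> \<epsilon> * t\<^sup>2"
    if t: "0 < t" "t < min r (\<delta> / 2)" for t
  proof -
    have "\<exists>\<sigma>. 0 < \<sigma> \<and> \<sigma> < t \<and> (h t t - h t 0) - (h 0 t - h 0 0) = (t - 0) * (p \<sigma> t - p \<sigma> 0)"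
      using t by (intro MVT2[where f = "\<lambda>s. h s t - h s 0" and f' = "\<lambda>s. p s t - p s 0"])
        (simp_all add: DERIV_diff der)
    then obtain \<sigma> where \<sigma>: "0 < \<sigma>" "\<sigma> < t"
      and mv: "h t t - h t 0 - h 0 t + h 0 0 = t * (p \<sigma> t - p \<sigma> 0)"
      by (auto simp: algebra_simps)
    have n1: "norm (\<sigma>, t) \<le> 2 * t"
      using norm_Pair_le[of \<sigma> t] \<sigma> by simp
    have n2: "norm (\<sigma>, 0::real) \<le> t"
      using \<sigma> by (simp add: norm_Pair)
    have a1: "\<bar>p \<sigma> t - p 0 0 - p' (\<sigma>, t)\<bar> \<le> \<epsilon> / 3 * (2 * t)"
      using order_trans[OF app[of \<sigma> t] mult_left_mono[OF n1]] n1 t \<open>0 < \<epsilon>\<close> by simp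
    have a2: "\<bar>p \<sigma> 0 - p 0 0 - p' (\<sigma>, 0)\<bar> \<le> \<epsilon> / 3 * t"
      using order_trans[OF app[of \<sigma> 0] mult_left_mono[OF n2]] n2 t \<open>0 < \<epsilon>\<close> by simp
    have "p' (\<sigma>, t) - p' (\<sigma>, 0) = p' (t *\<^sub>R (0, 1))"
      by (simp flip: p'.diff)
    then have "p' (\<sigma>, t) - p' (\<sigma>, 0) = t * p' (0, 1)"
      by (simp only: p'.scaleR real_scaleR_def)
    then have "\<bar>(p \<sigma> t - p \<sigma> 0) - t * p' (0, 1)\<bar> \<le> \<epsilon> * t"
      using a1 a2 by linarith
    then have "\<bar>t\<bar> * \<bar>(p \<sigma> t - p \<sigma> 0) - t * p' (0, 1)\<bar> \<le> t * (\<epsilon> * t)"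
      using t by (simp add: mult_left_mono)
    moreover have "t * (p \<sigma> t - p \<sigma> 0) - t\<^sup>2 * p' (0, 1) = t * ((p \<sigma> t - p \<sigma> 0) - t * p' (0, 1))"
      by (simp add: power2_eq_square algebra_simps)
    ultimately show ?thesis
      unfolding mv by (simp add: abs_mult power2_eq_square mult.left_commute)
  qed
  then show ?thesis
    using \<delta> \<open>0 < r\<close> by (intro exI[of _ "min r (\<delta> / 2)"]) auto
qed

text \<open>The second difference over a square is symmetric in the two arguments, so both mixed
  derivatives are its limit after division by the area.\<close>

lemma mixed_partials_commute:
  fixes h p q :: "real \<Rightarrow> real \<Rightarrow> real"
  assumes "0 < r"
    and derp: "\<And>s t. \<lbrakk>\<bar>s\<bar> < r; \<bar>t\<bar> < r\<rbrakk> \<Longrightarrow> ((\<lambda>s. h s t) has_real_derivative p s t) (at s)"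
    and derq: "\<And>s t. \<lbrakk>\<bar>s\<bar> < r; \<bar>t\<bar> < r\<rbrakk> \<Longrightarrow> ((\<lambda>t. h s t) has_real_derivative q s t) (at t)"
    and p: "((\<lambda>z. p (fst z) (snd z)) has_derivative p') (at (0, 0))"
    and q: "((\<lambda>z. q (fst z) (snd z)) has_derivative q') (at (0, 0))"
  shows "p' (0, 1) = q' (1, 0)"
proof (rule ccontr)
  assume ne: "p' (0, 1) \<noteq> q' (1, 0)"
  \<comment> \<open>The two approximation errors together reach at most two thirds of the supposed
    gap.\<close>
  define \<epsilon> where "\<epsilon> = \<bar>p' (0, 1) - q' (1, 0)\<bar> / 3"
  have \<epsilon>: "\<epsilon> > 0"
    using ne by (simp add: \<epsilon>_def)
  obtain d1 where d1: "d1 > 0" "\<And>t. 0 < t \<Longrightarrow> t < d1 \<Longrightarrow>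
    \<bar>(h t t - h t 0 - h 0 t + h 0 0) - t\<^sup>2 * p' (0, 1)\<bar> \<le> \<epsilon> * t\<^sup>2"
    using second_difference_limit[OF \<open>0 < r\<close> \<epsilon> derp p] by blast
  have sw: "((\<lambda>z. q (snd z) (fst z)) has_derivative (\<lambda>z. q' (snd z, fst z))) (at (0, 0))"
  proof -
    have "((\<lambda>z. (snd z, fst z)) has_derivative (\<lambda>z. (snd z, fst z))) (at (0::real, 0::real))"
      by (intro has_derivative_Pair derivative_intros)
    from has_derivative_compose[OF this, of "\<lambda>z. q (fst z) (snd z)" q'] q show ?thesis
      by simp
  qed
  obtain d2 where d2: "d2 > 0" "\<And>t. 0 < t \<Longrightarrow> t < d2 \<Longrightarrow>
    \<bar>(h t t - h 0 t - h t 0 + h 0 0) - t\<^sup>2 * q' (1, 0)\<bar> \<le> \<epsilon> * t\<^sup>2"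
    using second_difference_limit[OF \<open>0 < r\<close> \<epsilon>, of "\<lambda>s t. h t s" "\<lambda>s t. q t s" "\<lambda>z. q' (snd z, fst z)"]
      derq sw by auto
  define t where "t = min d1 d2 / 2"
  have t: "0 < t" "t < d1" "t < d2"
    using d1(1) d2(1) by (auto simp: t_def min_def)
  have "\<bar>t\<^sup>2 * p' (0, 1) - t\<^sup>2 * q' (1, 0)\<bar> \<le> 2 * (\<epsilon> * t\<^sup>2)"
    using d1(2)[OF t(1,2)] d2(2)[OF t(1,3)] by linarith
  also have "\<bar>t\<^sup>2 * p' (0, 1) - t\<^sup>2 * q' (1, 0)\<bar> = t\<^sup>2 * \<bar>p' (0, 1) - q' (1, 0)\<bar>"
    by (simp flip: right_diff_distrib add: abs_mult)
  also have "2 * (\<epsilon> * t\<^sup>2) = t\<^sup>2 * (2 * \<epsilon>)"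
    by simp
  finally have "\<bar>p' (0, 1) - q' (1, 0)\<bar> \<le> 2 * \<epsilon>"
    using t by simp
  then show False
    using \<epsilon> by (simp add: \<epsilon>_def)
qed

section \<open>Decomposable multivectors\<close>

text \<open>Left multiplication by the generator \<open>b\<^sub>i\<close>.\<close>

definition gen_wedge :: "nat \<Rightarrow> multivector \<Rightarrow> multivector" where
  "gen_wedge i a = (\<lambda>K. if finite K \<and> i \<in> K then (- 1) ^ card {j\<in>K. j < i} * a (K - {i}) else 0)"

text \<open>For \<open>i < j\<close>, deleting \<open>j\<close> does not change the number of
  elements below \<open>i\<close>, while deleting \<open>i\<close> lowers the number below
  \<open>j\<close> by one. This is the single change of sign.\<close>

lemma gen_wedge_anticommute: "gen_wedge i (gen_wedge j a) K = - gen_wedge j (gen_wedge i a) K"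
proof -
  have *: "gen_wedge i (gen_wedge j a) K = - gen_wedge j (gen_wedge i a) K"
    if "i < j" "finite K" "i \<in> K" "j \<in> K" for i j
  proof -
    have 1: "{l \<in> K - {j}. l < i} = {l \<in> K. l < i}"
      using that by auto
    have "{l \<in> K. l < j} = insert i {l \<in> K - {i}. l < j}"
      using that by auto
    then have 2: "card {l \<in> K. l < j} = Suc (card {l \<in> K - {i}. l < j})"
      using that by simp
    have 3: "K - {i} - {j} = K - {j} - {i}"
      by blast
    show ?thesis
      using that unfolding gen_wedge_def 1 2 3 by simp
  qed
  show ?thesis
  proof (cases "finite K \<and> i \<in> K \<and> j \<in> K \<and> i \<noteq> j")
    case True
    then consider "i < j" | "j < i"
      by (metis linorder_neqE_nat)
    then show ?thesis
      using *[of i j] *[of j i] True by cases simp_all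
  qed (auto simp: gen_wedge_def)
qed

definition blade :: "nat set \<Rightarrow> multivector" where
  "blade I = (\<lambda>K. if K = I then 1 else 0)"

lemma gen_wedge_blade_min:
  assumes "finite A" "\<And>a. a \<in> A \<Longrightarrow> b < a"
  shows "gen_wedge b (blade A) = blade (insert b A)"
proof
  fix K
  have b: "b \<notin> A" "{j \<in> insert b A. j < b} = {}"
    using assms(2) by force+
  show "gen_wedge b (blade A) K = blade (insert b A) K"
  proof (cases "K = insert b A")
    case True
    then show ?thesis
      using assms(1) b unfolding gen_wedge_def blade_def True b(2) by simp
  next
    case False
    then have "\<not> (b \<in> K \<and> K - {b} = A)"
      by blast
    then show ?thesis
      using False by (auto simp: gen_wedge_def blade_def)
  qed
qed

context graded_basis
begin

lemma mv_vec_singleton: "i \<in> {1..DIM('a)} \<Longrightarrow> mv_vec v {i} = v \<bullet> e i"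
  by (simp add: mv_vec_def)

lemma mv_vec_eq_0: "(\<And>i. i \<in> {1..DIM('a)} \<Longrightarrow> I \<noteq> {i}) \<Longrightarrow> mv_vec v I = 0"
  by (auto simp: mv_vec_def)

text \<open>Only singletons contribute to the sum over subsets. All signs are thereby confined to
  \<open>gen_wedge\<close>, and the general shuffle sign does not occur again.\<close>

lemma wedge_mv_vec:
  "wedge (mv_vec v) a K = (\<Sum>i=1..DIM('a). (v \<bullet> e i) * gen_wedge i a K)"
proof (cases "finite K")
  \<comment> \<open>A sum over an infinite set is 0, which matches the cut-off of
    \<open>gen_wedge\<close> at infinite \<open>K\<close>.\<close>
  case False
  then have "infinite (Pow K)"
    by simp
  then have "wedge (mv_vec v) a K = 0"
    unfolding wedge_def by (rule sum.infinite)
  then show ?thesis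
    using False by (simp add: gen_wedge_def)
next
  case True
  let ?f = "\<lambda>I. shuffle_sign I (K - I) * mv_vec v I * a (K - I)"
  let ?D = "K \<inter> {1..DIM('a)}"
  have sign: "shuffle_sign {i} (K - {i}) = (- 1) ^ card {j\<in>K. j < i}" for i
  proof -
    have "{(i', j). i' \<in> {i} \<and> j \<in> K - {i} \<and> j < i'} = Pair i ` {j\<in>K. j < i}"
      by auto
    then show ?thesis
      by (simp add: shuffle_sign_def card_image inj_on_def)
  qed
  have "sum ?f (Pow K) = sum ?f ((\<lambda>i. {i}) ` ?D)"
  proof (rule sum.mono_neutral_right)
    show "\<forall>I\<in>Pow K - (\<lambda>i. {i}) ` ?D. ?f I = 0"
    proof
      fix I assume I: "I \<in> Pow K - (\<lambda>i. {i}) ` ?D"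
      have "mv_vec v I = 0"
        by (rule mv_vec_eq_0) (use I in blast)
      then show "?f I = 0"
        by simp
    qed
  qed (use True in auto)
  also have "\<dots> = (\<Sum>i\<in>?D. ?f {i})"
    by (subst sum.reindex) (auto simp: inj_on_def)
  also have "\<dots> = (\<Sum>i\<in>?D. (v \<bullet> e i) * gen_wedge i a K)"
    by (rule sum.cong) (use True in \<open>auto simp: sign gen_wedge_def mv_vec_singleton\<close>)
  also have "\<dots> = (\<Sum>i=1..DIM('a). (v \<bullet> e i) * gen_wedge i a K)"
    by (rule sum.mono_neutral_left) (auto simp: gen_wedge_def)
  finally show ?thesis
    by (simp add: wedge_def)
qed

lemma wedge_mv_vec_e:
  assumes "i \<in> {1..DIM('a)}"
  shows "wedge (mv_vec (e i)) a = gen_wedge i a"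
proof
  fix K
  have "wedge (mv_vec (e i)) a K = (\<Sum>j=1..DIM('a). if i = j then gen_wedge j a K else 0)"
    unfolding wedge_mv_vec by (rule sum.cong) (use assms in \<open>auto simp: e_orthonormal\<close>)
  then show "wedge (mv_vec (e i)) a K = gen_wedge i a K"
    using assms by simp
qed

lemma gen_wedge_sum:
  "gen_wedge i (\<lambda>K. \<Sum>j\<in>A. c j * f j K) K = (\<Sum>j\<in>A. c j * gen_wedge i (f j) K)"
  by (cases "finite K \<and> i \<in> K") (auto simp: gen_wedge_def sum_distrib_left mult.left_commute)

lemma wedge_mv_vec_sum:
  "wedge (mv_vec v) (\<lambda>K. \<Sum>j\<in>A. c j * f j K) K = (\<Sum>j\<in>A. c j * wedge (mv_vec v) (f j) K)"
  unfolding wedge_mv_vec gen_wedge_sum sum_distrib_left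
  by (subst sum.swap) (simp add: mult.left_commute)

lemma wedge_mv_vec_scale: "wedge (mv_vec v) (\<lambda>K. c * a K) = (\<lambda>K. c * wedge (mv_vec v) a K)"
  using wedge_mv_vec_sum[of v "\<lambda>_. c" "\<lambda>_. a" "{()}"] by auto

lemma wedge_mv_vec_zero: "wedge (mv_vec v) (\<lambda>K. 0) = (\<lambda>K. 0)"
  using wedge_mv_vec_scale[of v 0 "\<lambda>_. 0"] by simp

lemma linear_wedge_mv_vec: "linear (\<lambda>v. wedge (mv_vec v) a K)"
  by (rule linearI)
     (simp_all add: wedge_mv_vec inner_add_left distrib_right sum.distrib sum_distrib_left mult.assoc)

lemma wedge_mv_vec_anticommute:
  "wedge (mv_vec u) (wedge (mv_vec v) a) K = - wedge (mv_vec v) (wedge (mv_vec u) a) K"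
proof -
  have ex: "wedge (mv_vec u) (wedge (mv_vec v) a) K
      = (\<Sum>i=1..DIM('a). \<Sum>j=1..DIM('a). (u \<bullet> e i) * (v \<bullet> e j) * gen_wedge i (gen_wedge j a) K)" for u v
  proof -
    have "wedge (mv_vec v) a = (\<lambda>K. \<Sum>j=1..DIM('a). (v \<bullet> e j) * gen_wedge j a K)"
      by (rule ext) (rule wedge_mv_vec)
    then show ?thesis
      by (simp only: wedge_mv_vec[of u] gen_wedge_sum sum_distrib_left mult.assoc)
  qed
  have "wedge (mv_vec u) (wedge (mv_vec v) a) K
      = (\<Sum>j=1..DIM('a). \<Sum>i=1..DIM('a). (u \<bullet> e i) * (v \<bullet> e j) * gen_wedge i (gen_wedge j a) K)"
    unfolding ex by (rule sum.swap)
  also have "\<dots> = (\<Sum>j=1..DIM('a). \<Sum>i=1..DIM('a). - ((v \<bullet> e j) * (u \<bullet> e i) * gen_wedge j (gen_wedge i a) K))"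
  proof (intro sum.cong refl)
    fix i j
    show "(u \<bullet> e i) * (v \<bullet> e j) * gen_wedge i (gen_wedge j a) K
        = - ((v \<bullet> e j) * (u \<bullet> e i) * gen_wedge j (gen_wedge i a) K)"
      by (subst gen_wedge_anticommute) simp
  qed
  also have "\<dots> = - wedge (mv_vec v) (wedge (mv_vec u) a) K"
    unfolding ex by (simp add: sum_negf)
  finally show ?thesis .
qed

lemma wedge_mv_vec_twice: "wedge (mv_vec v) (wedge (mv_vec v) a) = (\<lambda>K. 0)"
proof
  fix K
  show "wedge (mv_vec v) (wedge (mv_vec v) a) K = 0"
    using wedge_mv_vec_anticommute[of v v a K] by linarith
qed

lemma wedge_vecs_Cons: "wedge_vecs (v # vs) = wedge (mv_vec v) (wedge_vecs vs)"
  by (simp add: wedge_vecs_def)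

lemma wedge_vecs_Nil: "wedge_vecs [] = mv_one"
  by (simp add: wedge_vecs_def)

text \<open>A factor is moved by anticommutation to its own copy, where the product vanishes;
  linearity in the vector extends this to the span.\<close>

lemma wedge_vecs_span:
  assumes "w \<in> span (set vs)"
  shows "wedge (mv_vec w) (wedge_vecs vs) = (\<lambda>K. 0)"
proof
  fix K
  have mem: "wedge (mv_vec x) (wedge_vecs vs) = (\<lambda>K. 0)" if "x \<in> set vs" for x
    using that
  proof (induction vs)
    case (Cons v vs)
    show ?case
    proof (cases "x = v")
      case True
      then show ?thesis
        by (simp add: wedge_vecs_Cons wedge_mv_vec_twice)
    next
      case False
      with Cons have "wedge (mv_vec x) (wedge_vecs vs) = (\<lambda>K. 0)"
        by simp
      then show ?thesis
        by (intro ext) (simp add: wedge_vecs_Cons wedge_mv_vec_anticommute[of x v] wedge_mv_vec_zero)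
    qed
  qed simp
  show "wedge (mv_vec w) (wedge_vecs vs) K = 0"
    using linear_eq_0_on_span[OF linear_wedge_mv_vec _ assms, of "wedge_vecs vs" K] mem by simp
qed

text \<open>With \<open>D\<close> the indices of the first layer this yields pure degree; with
  \<open>D = UNIV\<close> it yields membership in \<open>left_inv_mv\<close>.\<close>

lemma wedge_vecs_coeff:
  assumes "\<And>v i. \<lbrakk>v \<in> set vs; i \<in> {1..DIM('a)}; v \<bullet> e i \<noteq> 0\<rbrakk> \<Longrightarrow> i \<in> D"
    and "wedge_vecs vs I \<noteq> 0"
  shows "I \<subseteq> {1..DIM('a)} \<inter> D \<and> card I = length vs"
  using assms
proof (induction vs arbitrary: I)
  case Nil
  then show ?case
    by (auto simp: wedge_vecs_Nil mv_one_def split: if_splits)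
next
  case (Cons v vs)
  then have "(\<Sum>i=1..DIM('a). (v \<bullet> e i) * gen_wedge i (wedge_vecs vs) I) \<noteq> 0"
    by (simp add: wedge_vecs_Cons wedge_mv_vec)
  then obtain i where i: "i \<in> {1..DIM('a)}" "(v \<bullet> e i) * gen_wedge i (wedge_vecs vs) I \<noteq> 0"
    by (meson sum.not_neutral_contains_not_neutral)
  then have I: "finite I" "i \<in> I" "wedge_vecs vs (I - {i}) \<noteq> 0"
    by (auto simp: gen_wedge_def split: if_splits)
  have iD: "i \<in> D"
    using i by (intro Cons.prems(1)[of v]) auto
  have "I - {i} \<subseteq> {1..DIM('a)} \<inter> D \<and> card (I - {i}) = length vs"
    by (rule Cons.IH[OF _ I(3)]) (use Cons.prems(1) in auto)
  then show ?case
    using iD i(1) I card_Suc_Diff1[OF I(1,2)] by auto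
qed

section \<open>The map induced on the exterior algebra by a linear map\<close>

definition mv_map :: "('a \<Rightarrow> 'a) \<Rightarrow> multivector \<Rightarrow> multivector" where
  "mv_map G c = (\<lambda>K. \<Sum>I\<in>Pow {1..DIM('a)}.
     c I * wedge_vecs (map (\<lambda>i. G (e i)) (sorted_list_of_set I)) K)"

lemma mv_field_eq_mv_map: "mv_field c p = mv_map (frechet_derivative (mult p) (at 0)) c"
  by (simp add: mv_field_def mv_map_def frame_wedge_def frame_def)

lemma mv_map_sum:
  "mv_map G (\<lambda>K. \<Sum>j\<in>A. c j * f j K) K = (\<Sum>j\<in>A. c j * mv_map G (f j) K)"
  unfolding mv_map_def sum_distrib_left sum_distrib_right
  by (subst sum.swap) (simp add: mult.assoc)

lemma mv_map_zero: "mv_map G (\<lambda>K. 0) = (\<lambda>K. 0)"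
  by (simp add: mv_map_def)

lemma sorted_list_of_set_insert_min:
  assumes "finite A" "\<And>a. a \<in> A \<Longrightarrow> b < a"
  shows "sorted_list_of_set (insert b A) = b # sorted_list_of_set A"
proof -
  have b: "b \<notin> A"
    using assms(2) by blast
  show ?thesis
    using assms b by (simp add: insort_is_Cons less_imp_le)
qed

text \<open>The images \<open>G i\<close> obey the sign rules of the generators, which is what makes
  \<open>mv_map\<close> multiplicative. Adjoining the least index \<open>b\<close> puts
  \<open>G b\<close> in front of the sorted product; for \<open>i\<close> above \<open>b\<close> one
  transposition gives the extra sign and the induction hypothesis handles the rest.\<close>

lemma wedge_blade_image:
  fixes G :: "nat \<Rightarrow> 'a"
  assumes "finite J"
  defines "w \<equiv> \<lambda>I. wedge_vecs (map G (sorted_list_of_set I))"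
  shows "wedge (mv_vec (G i)) (w J) K =
    (if i \<in> J then 0 else (- 1) ^ card {j\<in>J. j < i} * w (insert i J) K)"
  using assms(1)
proof (induction J arbitrary: i K rule: finite_linorder_min_induct)
  case empty
  then show ?case
    by (simp add: w_def wedge_vecs_Cons)
next
  case (insert b A)
  have fin: "finite A" and min: "\<And>a. a \<in> A \<Longrightarrow> b < a"
    using insert by auto
  have w_min: "w (Set.insert c B) = wedge (mv_vec (G c)) (w B)"
    if "finite B" "\<And>a. a \<in> B \<Longrightarrow> c < a" for c B
    by (simp add: w_def sorted_list_of_set_insert_min[OF that] wedge_vecs_Cons)
  have wb: "w (Set.insert b A) = wedge (mv_vec (G b)) (w A)"
    using w_min[OF fin min] .
  consider "i < b" | "i = b" | "b < i"
    by linarith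
  then show ?case
  proof cases
    case 1
    then have 2: "i < a" if "a \<in> Set.insert b A" for a
      using min that by force
    then have 3: "i \<notin> Set.insert b A" "{j \<in> Set.insert b A. j < i} = {}"
      by force+
    show ?thesis
      unfolding 3(2) using w_min[of "Set.insert b A" i] fin 2 3(1) by simp
  next
    case 2
    then show ?thesis
      by (simp add: wb wedge_mv_vec_twice)
  next
    case 3
    have wA: "wedge (mv_vec (G i)) (w A) =
       (\<lambda>K. (if i \<in> A then 0 else (- 1) ^ card {j\<in>A. j < i}) * w (Set.insert i A) K)"
      using insert.IH[of i] by auto
    have "wedge (mv_vec (G i)) (w (Set.insert b A)) K = - wedge (mv_vec (G b)) (wedge (mv_vec (G i)) (w A)) K"
      unfolding wb by (rule wedge_mv_vec_anticommute)
    also have "\<dots> = - ((if i \<in> A then 0 else (- 1) ^ card {j\<in>A. j < i}) *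
        wedge (mv_vec (G b)) (w (Set.insert i A)) K)"
      unfolding wA wedge_mv_vec_scale by simp
    also have "wedge (mv_vec (G b)) (w (Set.insert i A)) = w (Set.insert i (Set.insert b A))"
    proof -
      have "b < a" if "a \<in> Set.insert i A" for a
        using that min 3 by blast
      then show ?thesis
        using w_min[of "Set.insert i A" b] fin by (simp add: insert_commute)
    qed
    finally have *: "wedge (mv_vec (G i)) (w (Set.insert b A)) K =
      - ((if i \<in> A then 0 else (- 1) ^ card {j\<in>A. j < i}) * w (Set.insert i (Set.insert b A)) K)" .
    have "{j \<in> Set.insert b A. j < i} = Set.insert b {j\<in>A. j < i}" "b \<notin> A"
      using 3 min by auto
    then have "card {j \<in> Set.insert b A. j < i} = Suc (card {j\<in>A. j < i})"
      using fin by simp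
    then show ?thesis
      using * 3 by simp
  qed
qed

lemma mv_map_gen_wedge:
  assumes i: "i \<in> {1..DIM('a)}"
  shows "mv_map G (gen_wedge i a) K = wedge (mv_vec (G (e i))) (mv_map G a) K"
proof -
  let ?w = "\<lambda>I. wedge_vecs (map (\<lambda>i. G (e i)) (sorted_list_of_set I))"
  let ?P = "Pow {1..DIM('a)}"
  have "mv_map G (gen_wedge i a) K = (\<Sum>I\<in>{I\<in>?P. i \<in> I}. gen_wedge i a I * ?w I K)"
    unfolding mv_map_def by (rule sum.mono_neutral_right) (auto simp: gen_wedge_def)
  also have "\<dots> = (\<Sum>J\<in>{J\<in>?P. i \<notin> J}. a J * ((- 1) ^ card {j\<in>J. j < i} * ?w (insert i J) K))"
  proof (rule sum.reindex_bij_witness[of _ "insert i" "\<lambda>I. I - {i}"])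
    fix I assume I: "I \<in> {I\<in>?P. i \<in> I}"
    then have "finite I"
      using finite_subset by auto
    moreover have "insert i (I - {i}) = I" "{j\<in>I - {i}. j < i} = {j\<in>I. j < i}"
      using I by auto
    ultimately show "a (I - {i}) * ((- 1) ^ card {j\<in>I - {i}. j < i} * ?w (insert i (I - {i})) K)
        = gen_wedge i a I * ?w I K"
      using I by (simp add: gen_wedge_def)
  qed (use i in auto)
  also have "\<dots> = (\<Sum>J\<in>?P. a J * wedge (mv_vec (G (e i))) (?w J) K)"
  proof -
    have "wedge (mv_vec (G (e i))) (?w J) K =
        (if i \<in> J then 0 else (- 1) ^ card {j\<in>J. j < i} * ?w (insert i J) K)" if "J \<in> ?P" for J
      using that by (intro wedge_blade_image[of J "\<lambda>i. G (e i)"]) (auto intro: finite_subset)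
    then show ?thesis
      by (intro sum.mono_neutral_cong_left) auto
  qed
  also have "\<dots> = wedge (mv_vec (G (e i))) (mv_map G a) K"
    unfolding mv_map_def wedge_mv_vec_sum ..
  finally show ?thesis .
qed

lemma sum_e_representation: "(\<Sum>i=1..DIM('a). (x \<bullet> e i) *\<^sub>R e i) = x"
proof -
  let ?B = "e ` {1..DIM('a)}"
  let ?y = "x - (\<Sum>i=1..DIM('a). (x \<bullet> e i) *\<^sub>R e i)"
  have inj: "inj_on e {1..DIM('a)}"
    by (rule inj_onI) (metis e_orthonormal zero_neq_one)
  have nz: "0 \<notin> ?B"
  proof
    assume "0 \<in> ?B"
    then obtain i where "i \<in> {1..DIM('a)}" "e i = 0"
      by force
    then show False
      using e_orthonormal[of i i] by simp
  qed
  have "pairwise orthogonal ?B"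
    by (rule pairwiseI) (auto simp: orthogonal_def e_orthonormal)
  then have "independent ?B"
    using nz by (rule pairwise_orthogonal_independent)
  then have span: "span ?B = UNIV"
    using card_ge_dim_independent[of ?B UNIV] inj by (auto simp: card_image)
  have "?y \<bullet> e j = 0" if j: "j \<in> {1..DIM('a)}" for j
  proof -
    have "(\<Sum>i=1..DIM('a). (x \<bullet> e i) * (e i \<bullet> e j)) = (\<Sum>i=1..DIM('a). if i = j then x \<bullet> e i else 0)"
      by (rule sum.cong) (use j in \<open>auto simp: e_orthonormal\<close>)
    then show ?thesis
      using j by (simp add: inner_diff_left inner_sum_left)
  qed
  then have "orthogonal ?y b" if "b \<in> ?B" for b
    using that by (auto simp: orthogonal_def)
  then have "orthogonal ?y ?y"
    by (intro orthogonal_to_span[of ?y ?B]) (simp_all only: span UNIV_I)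
  then show ?thesis
    by (simp add: orthogonal_def)
qed

lemma linear_e_expansion:
  fixes G :: "'a \<Rightarrow> 'a"
  assumes "linear G"
  shows "G v = (\<Sum>i=1..DIM('a). (v \<bullet> e i) *\<^sub>R G (e i))"
proof -
  have "G v = G (\<Sum>i=1..DIM('a). (v \<bullet> e i) *\<^sub>R e i)"
    by (simp only: sum_e_representation)
  then show ?thesis
    using assms by (simp add: linear_sum linear_scale)
qed

lemma mv_map_wedge:
  assumes "linear G"
  shows "mv_map G (wedge (mv_vec v) a) = wedge (mv_vec (G v)) (mv_map G a)"
proof
  fix K
  have "wedge (mv_vec v) a = (\<lambda>K. \<Sum>i=1..DIM('a). (v \<bullet> e i) * gen_wedge i a K)"
    by (rule ext) (rule wedge_mv_vec)
  then have "mv_map G (wedge (mv_vec v) a) K = (\<Sum>i=1..DIM('a). (v \<bullet> e i) * mv_map G (gen_wedge i a) K)"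
    by (simp only: mv_map_sum)
  also have "\<dots> = (\<Sum>i=1..DIM('a). (v \<bullet> e i) * wedge (mv_vec (G (e i))) (mv_map G a) K)"
    by (rule sum.cong) (simp_all add: mv_map_gen_wedge)
  also have "\<dots> = wedge (mv_vec (\<Sum>i=1..DIM('a). (v \<bullet> e i) *\<^sub>R G (e i))) (mv_map G a) K"
    by (simp add: linear_sum[OF linear_wedge_mv_vec] linear_scale[OF linear_wedge_mv_vec])
  finally show "mv_map G (wedge (mv_vec v) a) K = wedge (mv_vec (G v)) (mv_map G a) K"
    by (simp only: linear_e_expansion[OF assms, of v, symmetric])
qed

lemma mv_map_wedge_vecs:
  assumes "linear G"
  shows "mv_map G (wedge_vecs vs) = wedge_vecs (map G vs)"
proof (induction vs)
  case Nil
  have "mv_map G mv_one K = (\<Sum>I\<in>{{}}. mv_one I * wedge_vecs (map (\<lambda>i. G (e i)) (sorted_list_of_set I)) K)" for K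
    unfolding mv_map_def by (rule sum.mono_neutral_right) (auto simp: mv_one_def)
  then show ?case
    by (simp add: wedge_vecs_Nil fun_eq_iff) (simp add: mv_one_def)
qed (simp add: wedge_vecs_Cons mv_map_wedge assms)

lemma wedge_vecs_e:
  assumes "I \<subseteq> {1..DIM('a)}"
  shows "wedge_vecs (map e (sorted_list_of_set I)) = blade I"
proof -
  have "finite I"
    using assms finite_subset by blast
  then show ?thesis
    using assms
  proof (induction I rule: finite_linorder_min_induct)
    case empty
    then show ?case
      by (simp add: wedge_vecs_Nil mv_one_def blade_def)
  next
    case (insert b A)
    then have "sorted_list_of_set (Set.insert b A) = b # sorted_list_of_set A"
      by (intro sorted_list_of_set_insert_min) auto
    with insert show ?case
      by (simp add: wedge_vecs_Cons wedge_mv_vec_e gen_wedge_blade_min del: sorted_list_of_set_insert_remove)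
  qed
qed

text \<open>Recovers the coefficients of a left invariant multivector field from its value at one
  point. The support condition enters because \<open>mv_map\<close> reads only the coefficients at
  subsets of \<open>{1..DIM('a)}\<close>.\<close>

lemma mv_map_inverse:
  assumes "linear F" "linear G" "\<And>v. G (F v) = v"
    and supp: "\<And>I. c I \<noteq> 0 \<Longrightarrow> I \<subseteq> {1..DIM('a)}"
  shows "mv_map G (mv_map F c) = c"
proof
  fix K
  have "mv_map G (mv_map F c) K = (\<Sum>I\<in>Pow {1..DIM('a)}.
      c I * mv_map G (wedge_vecs (map (\<lambda>i. F (e i)) (sorted_list_of_set I))) K)"
    unfolding mv_map_def[of F] by (rule mv_map_sum)
  also have "\<dots> = (\<Sum>I\<in>Pow {1..DIM('a)}. c I * blade I K)"
    by (rule sum.cong) (simp_all add: mv_map_wedge_vecs assms(2,3) o_def wedge_vecs_e)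
  also have "\<dots> = (\<Sum>I\<in>Pow {1..DIM('a)}. if K = I then c I else 0)"
    by (rule sum.cong) (auto simp: blade_def)
  also have "\<dots> = c K"
    using supp[of K] by (auto simp: sum.delta')
  finally show "mv_map G (mv_map F c) K = c K" .
qed

text \<open>In place of a determinant, a linear map sends the vectors to the first \<open>n\<close>
  basis vectors. The induced map sends their product to a basis element of the exterior algebra, so
  the product cannot be zero.\<close>

lemma wedge_vecs_nonzero:
  assumes "distinct vs" "independent (set vs)"
  shows "wedge_vecs vs \<noteq> (\<lambda>K. 0)"
proof
  assume zero: "wedge_vecs vs = (\<lambda>K. 0)"
  define n where "n = length vs"
  have n: "n \<le> DIM('a)"
    using independent_card_le[OF assms(2)] distinct_card[OF assms(1)] by (simp add: n_def)
  obtain idx where idx: "\<And>k. k < n \<Longrightarrow> idx (vs ! k) = k"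
  proof
    show "the_inv_into {..<n} ((!) vs) (vs ! k) = k" if "k < n" for k
      using that assms(1) by (intro the_inv_into_f_f) (auto simp: inj_on_def n_def nth_eq_iff_index_eq)
  qed
  \<comment> \<open>List positions start at 0 and basis indices at 1, hence the
    \<open>Suc\<close>.\<close>
  obtain G where G: "linear G" "\<And>v. v \<in> set vs \<Longrightarrow> G v = e (Suc (idx v))"
    using linear_independent_extend[OF assms(2), of "\<lambda>v. e (Suc (idx v))"] by blast
  have "map G vs = map e (sorted_list_of_set {1..n})"
  proof (rule nth_equalityI)
    have 1: "sorted_list_of_set {1..n} = [1..<Suc n]"
      by (metis atLeastLessThanSuc_atLeastAtMost sorted_list_of_set_range)
    show "length (map G vs) = length (map e (sorted_list_of_set {1..n}))"
      by (simp add: n_def)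
    show "map G vs ! k = map e (sorted_list_of_set {1..n}) ! k" if "k < length (map G vs)" for k
    proof -
      have "sorted_list_of_set {1..n} ! k = Suc k"
        unfolding 1 using that by (simp add: n_def del: upt_Suc)
      then show ?thesis
        using that idx[of k] by (simp add: G(2) n_def)
    qed
  qed
  then have "mv_map G (wedge_vecs vs) = blade {1..n}"
    using n by (simp add: mv_map_wedge_vecs[OF G(1)] wedge_vecs_e)
  then have "blade {1..n} = (\<lambda>K. 0)"
    by (simp add: zero mv_map_zero)
  then have "blade {1..n} {1..n} = 0"
    by simp
  then show False
    by (simp add: blade_def)
qed

lemma wedge_vecs_eq_0_iff:
  assumes "distinct vs" "independent (set vs)"
  shows "wedge (mv_vec w) (wedge_vecs vs) = (\<lambda>K. 0) \<longleftrightarrow> w \<in> span (set vs)"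
proof
  assume zero: "wedge (mv_vec w) (wedge_vecs vs) = (\<lambda>K. 0)"
  show "w \<in> span (set vs)"
  proof (rule ccontr)
    assume w: "w \<notin> span (set vs)"
    then have "distinct (w # vs)" "independent (set (w # vs))"
      using assms span_base by (auto simp: independent_insert)
    then show False
      using wedge_vecs_nonzero[of "w # vs"] zero by (simp add: wedge_vecs_Cons)
  qed
qed (rule wedge_vecs_span)

end

section \<open>The group operation\<close>

text \<open>The pairing of \<open>g\<close> with the component \<open>z\<close> of \<open>d\<close>
  orthogonal to \<open>U\<close> vanishes near 0, and so does its derivative, the squared norm of
  \<open>z\<close>.\<close>

lemma vector_derivative_in_subspace:
  fixes g :: "real \<Rightarrow> 'a::euclidean_space"
  assumes g: "(g has_vector_derivative d) (at 0)" and U: "subspace U"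
    and mem: "eventually (\<lambda>t. g t \<in> U) (nhds 0)"
  shows "d \<in> U"
proof -
  obtain y z where y: "y \<in> span U" and z: "\<And>w. w \<in> span U \<Longrightarrow> orthogonal z w" and d: "d = y + z"
    using orthogonal_subspace_decomp_exists[of U d] by blast
  have yU: "y \<in> U"
    using y U by (simp add: span_eq_iff[THEN iffD2])
  have "((\<lambda>t. g t \<bullet> z) has_vector_derivative d \<bullet> z) (at 0)"
    using g by (rule bounded_linear.has_vector_derivative[OF bounded_linear_inner_left])
  moreover have "((\<lambda>t. g t \<bullet> z) has_vector_derivative 0) (at 0)"
  proof -
    have ev: "eventually (\<lambda>t. t \<in> UNIV \<longrightarrow> g t \<bullet> z = 0) (nhds 0)"
      using mem by eventually_elim
        (metis z inner_commute orthogonal_def span_base)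
    moreover have "((\<lambda>t. 0::real) has_vector_derivative 0) (at 0)"
      by simp
    ultimately show ?thesis
      using has_vector_derivative_cong_ev[OF ev, of 0] eventually_nhds_x_imp_x[OF ev] by simp
  qed
  ultimately have "d \<bullet> z = 0"
    by (rule vector_derivative_unique_at)
  moreover have "y \<bullet> z = 0"
    using z[OF y] by (simp add: orthogonal_def inner_commute)
  ultimately have "z = 0"
    by (simp add: d inner_add_left)
  then show ?thesis
    using d yU by simp
qed

section \<open>Filtration by degree and iterated brackets\<close>

context homogeneous_group
begin

text \<open>For \<open>1 \<le> j\<close> these are ideals of the Lie algebra. Error terms of the
  product are only located in this filtration, never computed.\<close>

definition filtration :: "nat \<Rightarrow> 'a set" where
  "filtration j = span (\<Union>i\<in>{j..}. H i)"

lemma subspace_filtration: "subspace (filtration j)"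
  by (simp add: filtration_def)

lemma filtration_antimono: "i \<le> j \<Longrightarrow> filtration j \<subseteq> filtration i"
  unfolding filtration_def by (intro span_mono UN_mono) auto

lemma layer_in_filtration: "j \<le> i \<Longrightarrow> H i \<subseteq> filtration j"
  unfolding filtration_def using span_superset by fastforce

lemma filtration_one: "filtration 1 = UNIV"
proof -
  have "span (\<Union>i\<in>{1..\<iota>}. H i) \<subseteq> filtration 1"
    unfolding filtration_def by (intro span_mono) auto
  then show ?thesis
    using layers_span by auto
qed

lemma filtration_above: "\<iota> < j \<Longrightarrow> filtration j = {0}"
proof -
  assume "\<iota> < j"
  then have "(\<Union>i\<in>{j..}. H i) = {0}"
    using layers_above by auto
  then show ?thesis
    by (simp add: filtration_def)
qed

lemma linear_br_left: "linear (\<lambda>x. br x y)" and linear_br_right: "linear (br x)"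
  using br_bilinear by (auto simp: bilinear_def)

lemma br_anticommute: "br x y = - br y x"
proof -
  have "br (x + y) (x + y) = br x x + br x y + (br y x + br y y)"
    using br_bilinear by (simp add: bilinear_ladd bilinear_radd)
  then show ?thesis
    by (simp add: br_alternating eq_neg_iff_add_eq_0)
qed

lemma br_filtration:
  assumes "1 \<le> i" "1 \<le> j" "x \<in> filtration i" "y \<in> filtration j"
  shows "br x y \<in> filtration (i + j)"
proof -
  have "br x y \<in> filtration (i + j)" if x: "x \<in> H k" "i \<le> k" for x k
  proof -
    have "subspace {y. br x y \<in> filtration (i + j)}"
      by (intro linear_subspace_linear_preimage[OF linear_br_right] subspace_filtration)
    moreover have "br x z \<in> filtration (i + j)" if "z \<in> H l" "j \<le> l" for z l
    proof -
      have "br x z \<in> H (k + l)"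
        using that x assms(1,2) by (intro br_layers) auto
      moreover have "H (k + l) \<subseteq> filtration (i + j)"
        using that x by (intro layer_in_filtration) auto
      ultimately show ?thesis
        by blast
    qed
    ultimately show ?thesis
      using span_minimal[of "\<Union>l\<in>{j..}. H l" "{y. br x y \<in> filtration (i + j)}"] assms(4)
      unfolding filtration_def[of j] by blast
  qed
  moreover have "subspace {x. br x y \<in> filtration (i + j)}"
    by (intro linear_subspace_linear_preimage[OF linear_br_left] subspace_filtration)
  ultimately show ?thesis
    using span_minimal[of "\<Union>k\<in>{i..}. H k" "{x. br x y \<in> filtration (i + j)}"] assms(3)
    unfolding filtration_def[of i] by blast
qed

text \<open>Pairing with a vector of one layer discards everything in deeper layers. This is how
  congruences modulo \<open>filtration 2\<close> and \<open>filtration 3\<close> become equations in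
  the first and second layer.\<close>

lemma layer_orthogonal_filtration:
  assumes "1 \<le> i" "i < j" "x \<in> H i" "y \<in> filtration j"
  shows "x \<bullet> y = 0"
proof -
  have "orthogonal x y"
    using assms(4) unfolding filtration_def
  proof (rule orthogonal_to_span)
    fix z assume "z \<in> (\<Union>k\<in>{j..}. H k)"
    then obtain k where "j \<le> k" "z \<in> H k"
      by blast
    then show "orthogonal x z"
      unfolding orthogonal_def using assms by (intro layers_orthogonal[of i k]) auto
  qed
  then show ?thesis
    by (simp add: orthogonal_def)
qed

lemma nested_br_filtration:
  "ws \<noteq> [] \<Longrightarrow> nested_br ws \<in> filtration (length ws)"
proof (induction ws rule: nested_br.induct)
  case (2 x)
  then show ?case
    using filtration_one by simp
next
  case (3 x y zs)
  then have "br x (nested_br (y # zs)) \<in> filtration (1 + length (y # zs))"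
    by (intro br_filtration) (use filtration_one in auto)
  then show ?case
    by simp
qed simp

lemma nested_br_commuting:
  assumes "\<And>x y. \<lbrakk>x \<in> set ws; y \<in> set ws\<rbrakk> \<Longrightarrow> br x y = 0" "2 \<le> length ws"
  shows "nested_br ws = 0"
  using assms
proof (induction ws rule: nested_br.induct)
  case (3 x y zs)
  show ?case
  proof (cases zs)
    case Nil
    then show ?thesis
      using 3 by simp
  next
    case (Cons z zs')
    then have "nested_br (y # zs) = 0"
      using 3 by simp
    then show ?thesis
      by (simp add: linear_0[OF linear_br_right])
  qed
qed auto

text \<open>The innermost bracket either contains a letter from \<open>filtration j\<close>, and so
  gains a degree, or is \<open>br p p = 0\<close>; outer brackets never lose depth.\<close>

lemma nested_br_raises_filtration:
  assumes "1 \<le> j" "set ws \<subseteq> insert p (filtration j)" "2 \<le> length ws"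
  shows "nested_br ws \<in> filtration (Suc j)"
  using assms(2,3)
proof (induction ws rule: nested_br.induct)
  case (3 x y zs)
  have raise: "br z w \<in> filtration (Suc j)" if "w \<in> filtration j" for z w
    using br_filtration[of 1 j z w] that assms(1) filtration_one by simp
  show ?case
  proof (cases zs)
    case Nil
    have "x \<in> filtration j \<or> y \<in> filtration j \<or> (x = p \<and> y = p)"
      using 3 by auto
    moreover have "br x y \<in> filtration (Suc j)" if "x \<in> filtration j"
      using raise[OF that, of y] br_anticommute[of x y] subspace_neg[OF subspace_filtration] by metis
    ultimately show ?thesis
      using raise Nil br_alternating subspace_0[OF subspace_filtration] by auto
  next
    case (Cons z zs')
    then have "nested_br (y # zs) \<in> filtration (Suc j)"
      using 3 by simp
    then have "nested_br (y # zs) \<in> filtration j"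
      using filtration_antimono[of j "Suc j"] by auto
    then show ?thesis
      using raise by simp
  qed
qed auto

section \<open>Low order terms of the Baker-Campbell-Hausdorff product\<close>

lemma set_bch_word: "set (bch_word x y rs) \<subseteq> {x, y}"
proof
  fix w assume "w \<in> set (bch_word x y rs)"
  then obtain r s where "w \<in> set (replicate r x) \<union> set (replicate s y)"
    unfolding bch_word_def set_concat set_map by fastforce
  then show "w \<in> {x, y}"
    using in_set_replicate by fast
qed

lemma length_bch_word: "length (bch_word x y rs) = (\<Sum>(r, s)\<leftarrow>rs. r + s)"
  by (induction rs) (auto simp: bch_word_def)

lemma bch_term_in_subspace:
  assumes U: "subspace U"
    and ws: "\<And>ws. \<lbrakk>set ws \<subseteq> {x, y}; length ws = N\<rbrakk> \<Longrightarrow> nested_br ws \<in> U"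
  shows "bch_term N x y \<in> U"
proof -
  have "nested_br (bch_word x y rs) \<in> U" if "rs \<in> bch_index N k" for rs k
    using that by (intro ws set_bch_word) (simp add: bch_index_def length_bch_word)
  then show ?thesis
    unfolding bch_term_def by (intro subspace_sum[OF U] subspace_scale[OF U])
qed

lemma bch_term_1: "bch_term 1 x y = x + y"
proof -
  have "bch_index 1 1 = {[(1, 0)], [(0, 1)]}"
    by (auto simp: bch_index_def length_Suc_conv)
  then show ?thesis
    by (simp add: bch_term_def bch_word_def)
qed

text \<open>The factor 1/2 comes from the index list \<open>[(1, 1)]\<close>. The two mixed lists of
  length 2 have equal coefficients and cancel, since the bracket is antisymmetric.\<close>

lemma bch_term_2: "bch_term 2 x y = (1 / 2) *\<^sub>R br x y"
proof -
  have 1: "bch_index 2 1 = {[(2, 0)], [(1, 1)], [(0, 2)]}"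
    by (auto simp: bch_index_def length_Suc_conv)
  have 2: "bch_index 2 2 = {[(1, 0), (1, 0)], [(1, 0), (0, 1)], [(0, 1), (1, 0)], [(0, 1), (0, 1)]}"
    (is "_ = ?R")
  proof
    show "bch_index 2 2 \<subseteq> ?R"
    proof
      fix rs assume rs: "rs \<in> bch_index 2 2"
      then have "length rs = Suc (Suc 0)"
        by (simp add: bch_index_def)
      then obtain a b c d where abcd: "rs = [(a, b), (c, d)]"
        by (metis length_0_conv length_Suc_conv surj_pair)
      with rs have "a + b = 1" "c + d = 1"
        by (auto simp: bch_index_def)
      then show "rs \<in> ?R"
        unfolding abcd by (cases a; cases c) auto
    qed
  qed (auto simp: bch_index_def)
  have rep: "replicate 2 z = [z, z]" for z :: 'a
    by (simp add: numeral_2_eq_2)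
  have "{Suc 0..2} = {1, 2::nat}"
    by auto
  then show ?thesis
    by (simp add: bch_term_def bch_word_def 1[simplified] 2 rep br_alternating br_anticommute[of y x])
qed

lemma mult_eq_add:
  assumes U: "subspace U"
    and ws: "\<And>ws. \<lbrakk>set ws \<subseteq> {x, y}; 2 \<le> length ws\<rbrakk> \<Longrightarrow> nested_br ws \<in> U"
  shows "mult x y - (x + y) \<in> U"
proof -
  have "mult x y = x + y + (\<Sum>N=2..\<iota>. bch_term N x y)"
    using step_pos unfolding mult_def
    by (simp add: sum.atLeast_Suc_atMost bch_term_1[simplified] numeral_2_eq_2)
  moreover have "(\<Sum>N=2..\<iota>. bch_term N x y) \<in> U"
    by (intro subspace_sum[OF U] bch_term_in_subspace[OF U] ws) auto
  ultimately show ?thesis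
    by simp
qed

lemma mult_second_order: "mult x y - (x + y + (1 / 2) *\<^sub>R br x y) \<in> filtration 3"
proof (cases "\<iota> = 1")
  \<comment> \<open>In step 1 the sum defining \<open>mult\<close> has no term of degree 2, but then
    the bracket vanishes as well.\<close>
  case True
  then have "br x y \<in> {0}"
    using br_filtration[of 1 1 x y] filtration_one filtration_above[of 2] by (auto simp: numeral_2_eq_2)
  then show ?thesis
    unfolding mult_def using subspace_0[OF subspace_filtration] True
    by (simp add: bch_term_1[simplified])
next
  case False
  then have "mult x y = x + y + ((1 / 2) *\<^sub>R br x y + (\<Sum>N=3..\<iota>. bch_term N x y))"
    using step_pos bch_term_2[of x y] unfolding mult_def
    by (simp add: sum.atLeast_Suc_atMost bch_term_1[simplified] numeral_2_eq_2 numeral_3_eq_3)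
  moreover have "bch_term N x y \<in> filtration 3" if "3 \<le> N" for N
  proof (rule bch_term_in_subspace[OF subspace_filtration])
    fix ws :: "'a list" assume "length ws = N"
    then have "nested_br ws \<in> filtration N"
      using nested_br_filtration[of ws] that by (cases ws) auto
    then show "nested_br ws \<in> filtration 3"
      using filtration_antimono[OF that] by blast
  qed
  then have "(\<Sum>N=3..\<iota>. bch_term N x y) \<in> filtration 3"
    by (intro subspace_sum[OF subspace_filtration]) auto
  ultimately show ?thesis
    by simp
qed

lemma mult_commuting:
  assumes "br x y = 0"
  shows "mult x y = x + y"
proof -
  have "nested_br ws \<in> {0}" if "set ws \<subseteq> {x, y}" "2 \<le> length ws" for ws
  proof -
    have "br y x = 0"
      using assms br_anticommute[of y x] by simp
    then have "nested_br ws = 0"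
      using that assms br_alternating by (intro nested_br_commuting) auto
    then show ?thesis
      by simp
  qed
  then show ?thesis
    using mult_eq_add[of "{0}" x y] subspace_single_0 by force
qed

lemma mult_0_right: "mult p 0 = p"
  using mult_commuting[of p 0] linear_0[OF linear_br_right] by simp

section \<open>Polynomiality of the group law\<close>

lemma polynomial_function_br:
  fixes f g :: "'b::real_normed_vector \<Rightarrow> 'a"
  assumes "polynomial_function f" "polynomial_function g"
  shows "polynomial_function (\<lambda>z. br (f z) (g z))"
proof -
  have expand: "br x y = (\<Sum>i\<in>Basis. \<Sum>j\<in>Basis. ((x \<bullet> i) * (y \<bullet> j)) *\<^sub>R br i j)" for x y
  proof -
    have "br x y = br (\<Sum>i\<in>Basis. (x \<bullet> i) *\<^sub>R i) (\<Sum>j\<in>Basis. (y \<bullet> j) *\<^sub>R j)"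
      by (simp only: euclidean_representation)
    also have "\<dots> = (\<Sum>i\<in>Basis. (x \<bullet> i) *\<^sub>R (\<Sum>j\<in>Basis. (y \<bullet> j) *\<^sub>R br i j))"
      unfolding linear_sum[OF linear_br_left] linear_scale[OF linear_br_left]
      unfolding linear_sum[OF linear_br_right] linear_scale[OF linear_br_right] by (rule refl)
    finally show ?thesis
      by (simp add: scaleR_sum_right)
  qed
  have comp: "polynomial_function (\<lambda>z. h z \<bullet> i)" if "polynomial_function h"
    for h :: "'b \<Rightarrow> 'a" and i
  proof -
    have "real_polynomial_function ((\<lambda>x. x \<bullet> i) \<circ> h)"
      using that bounded_linear_inner_left unfolding polynomial_function_def by blast
    then show ?thesis
      by (simp add: o_def real_polynomial_function_eq)
  qed
  have "polynomial_function (\<lambda>z. (f z \<bullet> i) * (g z \<bullet> j))" for i j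
    using comp[OF assms(1), of i] comp[OF assms(2), of j]
    by (auto simp flip: real_polynomial_function_eq)
  then have "polynomial_function (\<lambda>z. \<Sum>i\<in>Basis. \<Sum>j\<in>Basis. ((f z \<bullet> i) * (g z \<bullet> j)) *\<^sub>R br i j)"
    by (intro polynomial_function_sum polynomial_function_mult polynomial_function_const finite_Basis)
  moreover have "(\<lambda>z. br (f z) (g z)) = (\<lambda>z. \<Sum>i\<in>Basis. \<Sum>j\<in>Basis. ((f z \<bullet> i) * (g z \<bullet> j)) *\<^sub>R br i j)"
    by (intro ext expand)
  ultimately show ?thesis
    by (simp only:)
qed

lemma polynomial_function_nested_br:
  fixes fs :: "('b::real_normed_vector \<Rightarrow> 'a) list"
  assumes "\<And>f. f \<in> set fs \<Longrightarrow> polynomial_function f"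
  shows "polynomial_function (\<lambda>z. nested_br (map (\<lambda>f. f z) fs))"
  using assms
proof (induction fs rule: induct_list012)
  case (3 f g fs)
  then have "polynomial_function (\<lambda>z. br (f z) (nested_br (map (\<lambda>f. f z) (g # fs))))"
    by (intro polynomial_function_br) auto
  then show ?case
    by simp
qed auto

lemma polynomial_function_mult_pair: "polynomial_function (\<lambda>z. mult (fst z) (snd z))"
proof -
  have word: "polynomial_function (\<lambda>z. nested_br (bch_word (fst z) (snd z) rs))" for rs
  proof -
    \<comment> \<open>The word in the two factors is read as a word in the coordinate projections
      \<open>fst\<close> and \<open>snd\<close>, evaluated at \<open>z\<close>.\<close>
    let ?fs = "concat (map (\<lambda>(r, s). replicate r fst @ replicate s snd) rs) :: ('a \<times> 'a \<Rightarrow> 'a) list"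
    have "bch_word (fst z) (snd z) rs = map (\<lambda>f. f z) ?fs" for z
      by (induction rs) (auto simp: bch_word_def)
    moreover have "polynomial_function (\<lambda>z. nested_br (map (\<lambda>f. f z) ?fs))"
      by (rule polynomial_function_nested_br)
         (auto intro!: polynomial_function_bounded_linear bounded_linear_fst bounded_linear_snd)
    ultimately show ?thesis
      by simp
  qed
  have "polynomial_function (\<lambda>z. \<Sum>rs\<in>bch_index N k. c rs *\<^sub>R nested_br (bch_word (fst z) (snd z) rs))"
    for N k c
  \<comment> \<open>An infinite index set would give the sum 0, which is polynomial too.\<close>
  proof (cases "finite (bch_index N k)")
    case True
    then show ?thesis
      by (intro polynomial_function_sum polynomial_function_cmul word)
  next
    case False
    then show ?thesis
      by simp
  qed
  then show ?thesis
    unfolding mult_def bch_term_def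
    by (intro polynomial_function_sum[OF finite_atLeastAtMost] polynomial_function_cmul)
qed

lemma polynomial_function_mult_left: "polynomial_function (mult p)"
proof -
  have pair: "polynomial_function (\<lambda>x::'a. (p, x))"
  proof -
    have "bounded_linear (\<lambda>x. (0::'a, x::'a))"
      by (intro bounded_linear_Pair bounded_linear_zero bounded_linear_ident)
    then have "polynomial_function (\<lambda>x. (p, 0::'a) + (0::'a, x))"
      by (intro polynomial_function_add polynomial_function_const polynomial_function_bounded_linear)
    then show ?thesis
      by simp
  qed
  have "real_polynomial_function (\<lambda>x. f (mult p x))" if "bounded_linear f" for f
    using real_polynomial_function_compose[OF pair, of "f \<circ> (\<lambda>z. mult (fst z) (snd z))"]
      polynomial_function_mult_pair that
    by (simp add: polynomial_function_def o_def)
  then show ?thesis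
    by (simp add: polynomial_function_def o_def)
qed

section \<open>The differential of a left translation at the identity\<close>

definition left_deriv :: "'a \<Rightarrow> 'a \<Rightarrow> 'a" where
  "left_deriv p = frechet_derivative (mult p) (at 0)"

lemma has_derivative_mult_left: "(mult p has_derivative frechet_derivative (mult p) (at x)) (at x)"
  using polynomial_function_mult_left by (rule polynomial_second_derivative)

lemma linear_mult_derivative: "linear (frechet_derivative (mult p) (at x))"
  using has_derivative_mult_left by (rule has_derivative_linear)

lemma linear_left_deriv: "linear (left_deriv p)"
  unfolding left_deriv_def by (rule linear_mult_derivative)

lemma left_deriv_ray: "((\<lambda>t. mult p (t *\<^sub>R v)) has_vector_derivative left_deriv p v) (at 0)"
proof -
  have "((\<lambda>t. t *\<^sub>R v) has_vector_derivative v) (at 0)"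
    by (auto intro!: derivative_eq_intros)
  from vector_derivative_diff_chain_within[OF this has_derivative_at_withinI[OF has_derivative_mult_left]]
  show ?thesis
    by (simp add: o_def left_deriv_def)
qed

text \<open>Transfers congruences modulo a subspace from the product along a ray to the
  differential, so that the expansions of \<open>mult\<close> need no termwise
  differentiation.\<close>

lemma left_deriv_approx:
  assumes U: "subspace U" and "\<And>t. mult p (t *\<^sub>R v) - (p + t *\<^sub>R w) \<in> U"
  shows "left_deriv p v - w \<in> U"
proof (rule vector_derivative_in_subspace[OF _ U])
  show "((\<lambda>t. mult p (t *\<^sub>R v) - (p + t *\<^sub>R w)) has_vector_derivative left_deriv p v - w) (at 0)"
    by (auto intro!: derivative_eq_intros left_deriv_ray)
qed (use assms(2) in auto)

text \<open>The differential is unipotent with respect to the filtration: every bracket of length at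
  least 2 in \<open>p\<close> and \<open>v\<close> is deeper than \<open>v\<close>.\<close>

lemma left_deriv_filtration:
  assumes "1 \<le> j" "v \<in> filtration j"
  shows "left_deriv p v - v \<in> filtration (Suc j)"
proof (rule left_deriv_approx[OF subspace_filtration])
  fix t :: real
  show "mult p (t *\<^sub>R v) - (p + t *\<^sub>R v) \<in> filtration (Suc j)"
    using assms subspace_scale[OF subspace_filtration assms(2)]
    by (intro mult_eq_add subspace_filtration nested_br_raises_filtration[where p = p]) auto
qed

text \<open>By unipotence a kernel vector descends the filtration one level at a time until it lies
  in \<open>{0}\<close>.\<close>

lemma left_deriv_inject:
  assumes "left_deriv p v = left_deriv p w"
  shows "v = w"
proof -
  have 0: "left_deriv p (v - w) = 0"
    using assms by (simp add: linear_diff[OF linear_left_deriv])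
  have "v - w \<in> filtration (Suc j)" for j
  proof (induction j)
    case 0
    then show ?case
      using filtration_one by simp
  next
    case (Suc j)
    then have "- (v - w) \<in> filtration (Suc (Suc j))"
      using left_deriv_filtration[of "Suc j" "v - w" p] 0 by simp
    then show ?case
      using subspace_neg[OF subspace_filtration] by fastforce
  qed
  from this[of \<iota>] show ?thesis
    using filtration_above[of "Suc \<iota>"] by simp
qed

lemma left_deriv_second_order: "left_deriv p v - (v + (1 / 2) *\<^sub>R br p v) \<in> filtration 3"
proof (rule left_deriv_approx[OF subspace_filtration])
  fix t :: real
  show "mult p (t *\<^sub>R v) - (p + t *\<^sub>R (v + (1 / 2) *\<^sub>R br p v)) \<in> filtration 3"
    using mult_second_order[of p "t *\<^sub>R v"]
    by (simp add: linear_scale[OF linear_br_right] scaleR_add_right add.assoc)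
qed

lemma left_deriv_commuting:
  assumes "br p v = 0"
  shows "left_deriv p v = v"
proof -
  have "left_deriv p v - v \<in> {0}"
  proof (rule left_deriv_approx[OF subspace_single_0])
    show "mult p (t *\<^sub>R v) - (p + t *\<^sub>R v) \<in> {0}" for t
      using assms mult_commuting[of p "t *\<^sub>R v"] by (simp add: linear_scale[OF linear_br_right])
  qed
  then show ?thesis
    by simp
qed

lemma left_deriv_0: "left_deriv 0 v = v"
  by (rule left_deriv_commuting) (rule linear_0[OF linear_br_left])

lemma Lie_eq_left_deriv:
  assumes "X \<in> Lie"
  shows "X p = left_deriv p (X 0)"
proof -
  have "X (mult p 0) = left_deriv p (X 0)"
    using assms unfolding Lie_def left_deriv_def by blast
  then show ?thesis
    by (simp only: mult_0_right)
qed

end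

section \<open>Left invariant vector fields\<close>

context homogeneous_group
begin

text \<open>Here the base point varies, so \<open>left_deriv q v\<close> is read as the derivative
  of the jointly polynomial product at \<open>(q, 0)\<close> in direction \<open>(0, v)\<close>.
  Members of \<open>Lie\<close> are a priori arbitrary maps; their differentiability comes from
  here.\<close>

lemma left_deriv_differentiable: "(\<lambda>p. left_deriv p v) differentiable (at p)"
proof -
  let ?M = "\<lambda>z. mult (fst z) (snd z)"
  obtain M'' where M: "\<And>z. (?M has_derivative frechet_derivative ?M (at z)) (at z)"
    "\<And>z w. ((\<lambda>y. frechet_derivative ?M (at y) w) has_derivative (\<lambda>u. M'' z u w)) (at z)"
    by (rule polynomial_second_derivative[OF polynomial_function_mult_pair]) (rule that)
  have "left_deriv q v = frechet_derivative ?M (at (q, 0)) (0, v)" for q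
  proof -
    have "(Pair q has_derivative Pair 0) (at (0::'a))"
      by (intro has_derivative_Pair has_derivative_const has_derivative_ident)
    from has_derivative_compose[OF this, of ?M] M(1)[of "(q, 0)"]
    have "(mult q has_derivative (\<lambda>v. frechet_derivative ?M (at (q, 0)) (0, v))) (at 0)"
      by simp
    from fun_cong[OF frechet_derivative_at[OF this], of v] show ?thesis
      by (simp add: left_deriv_def)
  qed
  moreover have "((\<lambda>q. (q, 0::'a)) has_derivative (\<lambda>q. (q, 0))) (at p)"
    by (intro has_derivative_Pair has_derivative_const has_derivative_ident)
  from has_derivative_compose[OF this M(2)[where w = "(0, v)" and z = "(p, 0)"]]
  have "((\<lambda>q. frechet_derivative ?M (at (q, 0)) (0, v)) has_derivative (\<lambda>q. M'' (p, 0) (q, 0) (0, v))) (at p)"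
    by simp
  ultimately show ?thesis
    by (auto simp: differentiable_def)
qed

lemma Lie_has_derivative:
  assumes "X \<in> Lie"
  shows "(X has_derivative frechet_derivative X (at p)) (at p)"
proof -
  have "X = (\<lambda>p. left_deriv p (X 0))"
    using Lie_eq_left_deriv[OF assms] by blast
  then show ?thesis
    using left_deriv_differentiable frechet_derivative_works by metis
qed

text \<open>Differentiating the invariance of each field produces a second derivative of
  \<open>mult p\<close> at the pair \<open>X x\<close>, \<open>Y x\<close>. It occurs once in each
  order, so by symmetry the two terms cancel in the bracket.\<close>

lemma vf_bracket_left_invariant:
  assumes "X \<in> Lie" "Y \<in> Lie"
  shows "vf_bracket X Y (mult p x) = frechet_derivative (mult p) (at x) (vf_bracket X Y x)"
proof -
  let ?D = "\<lambda>x. frechet_derivative (mult p) (at x)"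
  obtain f'' where f: "\<And>x v. ((\<lambda>y. ?D y v) has_derivative (\<lambda>u. f'' x u v)) (at x)"
    "\<And>x u v. f'' x u v = f'' x v u"
    by (rule polynomial_second_derivative[OF polynomial_function_mult_left]) (rule that)
  have key: "frechet_derivative X (at (mult p x)) (?D x u) = f'' x u (X x) + ?D x (frechet_derivative X (at x) u)"
    if X: "X \<in> Lie" for X u
  proof -
    have "(\<lambda>y. X (mult p y)) = (\<lambda>y. ?D y (X y))"
      using X by (auto simp: Lie_def)
    moreover have "((\<lambda>y. ?D y (X y)) has_derivative
        (\<lambda>u. f'' x u (X x) + ?D x (frechet_derivative X (at x) u))) (at x)"
      by (rule has_derivative_frechet_derivative_apply[OF has_derivative_mult_left f(1) linear_mult_derivative f(2)
            Lie_has_derivative[OF X]])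
    ultimately have "(\<lambda>u. frechet_derivative X (at (mult p x)) (?D x u)) =
        (\<lambda>u. f'' x u (X x) + ?D x (frechet_derivative X (at x) u))"
      using has_derivative_compose[OF has_derivative_mult_left Lie_has_derivative[OF X], of p x]
      by (intro has_derivative_unique) simp_all
    then show ?thesis
      by metis
  qed
  have "X (mult p x) = ?D x (X x)" "Y (mult p x) = ?D x (Y x)"
    using assms by (auto simp: Lie_def)
  then show ?thesis
    using key[OF assms(1), of "Y x"] key[OF assms(2), of "X x"] f(2)[of x "X x" "Y x"]
    by (simp add: vf_bracket_def linear_diff[OF linear_mult_derivative])
qed

text \<open>Along the ray through a vector commuting with \<open>Y 0\<close> the field
  \<open>Y\<close> is constant, so the bracket vanishes at 0. Left invariance carries this to every
  point, without any formula for the bracket of general fields.\<close>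

lemma vf_bracket_commuting:
  assumes X: "X \<in> Lie" and Y: "Y \<in> Lie" and br: "br (X 0) (Y 0) = 0"
  shows "vf_bracket X Y = (\<lambda>p. 0)"
proof -
  have zero: "frechet_derivative Y (at 0) v = 0" if Y: "Y \<in> Lie" and "br v (Y 0) = 0" for Y v
  proof -
    have "((\<lambda>t. t *\<^sub>R v) has_vector_derivative v) (at 0)"
      by (auto intro!: derivative_eq_intros)
    from vector_derivative_diff_chain_within[OF this, of Y "frechet_derivative Y (at 0)"]
      Lie_has_derivative[OF Y, of 0]
    have "((\<lambda>t. Y (t *\<^sub>R v)) has_vector_derivative frechet_derivative Y (at 0) v) (at 0)"
      by (simp add: o_def has_derivative_at_withinI)
    moreover have "Y (t *\<^sub>R v) = Y 0" for t
      using Lie_eq_left_deriv[OF Y, of "t *\<^sub>R v"] that(2)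
      by (simp add: left_deriv_commuting linear_scale[OF linear_br_left])
    ultimately have "((\<lambda>t. Y 0) has_vector_derivative frechet_derivative Y (at 0) v) (at (0::real))"
      by simp
    then show ?thesis
      using vector_derivative_unique_at has_vector_derivative_const by blast
  qed
  have "br (Y 0) (X 0) = 0"
    using br br_anticommute[of "Y 0" "X 0"] by simp
  then have 0: "vf_bracket X Y 0 = 0"
    using zero[OF X] zero[OF Y br] by (simp add: vf_bracket_def)
  have "vf_bracket X Y p = 0" for p
    using vf_bracket_left_invariant[OF X Y, of p 0]
    by (simp add: mult_0_right 0 linear_0[OF linear_mult_derivative])
  then show ?thesis
    by blast
qed

lemma Lie_zero: "(\<lambda>p. 0) \<in> Lie"
  by (simp add: Lie_def linear_0[OF linear_mult_derivative])

lemma Lie_add: "X \<in> Lie \<Longrightarrow> Y \<in> Lie \<Longrightarrow> (\<lambda>p. X p + Y p) \<in> Lie"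
  by (simp add: Lie_def linear_add[OF linear_mult_derivative])

lemma Lie_scale: "X \<in> Lie \<Longrightarrow> (\<lambda>p. c *\<^sub>R X p) \<in> Lie"
  by (simp add: Lie_def linear_scale[OF linear_mult_derivative])

text \<open>\<open>P\<close> extracts the first layer component. It is the orthogonal projection
  onto \<open>H 1\<close>, and the orthogonality of the layers makes it vanish on
  \<open>filtration 2\<close>.\<close>

lemma horizontal_projection:
  obtains P where "linear P" "\<And>x. P x \<in> H 1" "\<And>x. x - P x \<in> filtration 2" "\<And>x. x \<in> H 1 \<Longrightarrow> P x = x"
    "\<And>x. x \<in> filtration 2 \<Longrightarrow> P x = 0"
proof -
  have H1: "subspace (H 1)"
    by (rule layer_subspace) simp
  obtain B where B: "B \<subseteq> H 1" "pairwise orthogonal B" "\<And>x. x \<in> B \<Longrightarrow> norm x = 1"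
    "independent B" "span B = H 1"
    using orthonormal_basis_subspace[OF H1] by metis
  have fin: "finite B"
    using B(4) by (rule finiteI_independent)
  define P where "P x = (\<Sum>b\<in>B. (x \<bullet> b) *\<^sub>R b)" for x
  have lin: "linear P"
    unfolding P_def by (rule linearI) (simp_all add: inner_add_left scaleR_add_left sum.distrib scaleR_sum_right)
  have P_H1: "P x = x" if "x \<in> H 1" for x
    unfolding P_def using B that fin by (intro orthonormal_basis_expand) auto
  have P_2: "P x = 0" if "x \<in> filtration 2" for x
  proof -
    have "x \<bullet> b = 0" if "b \<in> B" for b
      using layer_orthogonal_filtration[of 1 2 b x] \<open>x \<in> filtration 2\<close> that B(1)
      by (auto simp: inner_commute)
    then show ?thesis
      by (simp add: P_def)
  qed
  have "x - P x \<in> filtration 2" for x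
  proof -
    have "x \<in> filtration 1"
      by (simp only: filtration_one UNIV_I)
    moreover have "(\<Union>i\<in>{1..}. H i) = H 1 \<union> (\<Union>i\<in>{2..}. H i)"
    proof -
      have "{1..} = insert 1 {2..} - {0::nat}"
        by auto
      moreover have "insert 1 {2..} - {0::nat} = insert 1 {2..}"
        by auto
      ultimately show ?thesis
        by simp
    qed
    ultimately obtain h w where "h \<in> span (H 1)" "w \<in> filtration 2" "x = h + w"
      unfolding filtration_def by (auto simp: span_Un)
    then show ?thesis
      using H1 P_H1 P_2 by (simp add: linear_add[OF lin] span_eq_iff[THEN iffD2])
  qed
  moreover have "P x \<in> H 1" for x
    unfolding P_def using B(1) H1 by (intro subspace_sum subspace_scale) auto
  ultimately show ?thesis
    using that lin P_H1 P_2 by blast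
qed

end

section \<open>Parametrizing a submanifold\<close>

text \<open>\<open>\<psi>\<close> is the inverse of a slice chart, kept on an open set of the whole
  space so that its derivatives are ordinary ones; its restriction to \<open>L\<close> parametrizes
  \<open>S\<close>. The differentials of chart and inverse are mutually inverse. The chart sends
  curves in \<open>S\<close> to curves in \<open>L\<close>, with velocity in \<open>L\<close>;
  conversely \<open>\<psi>\<close> sends short line segments in \<open>L\<close> to curves in
  \<open>S\<close>.\<close>

lemma embedded_C1_submanifold_parametrization:
  fixes S :: "'a::euclidean_space set"
  assumes S: "embedded_C1_submanifold n S" and p: "p \<in> S"
  obtains V :: "'a set" and \<psi> :: "'a \<Rightarrow> 'a" and \<psi>' L a where
    "open V" "a \<in> V" "a \<in> L" "subspace L" "dim L = n" "\<psi> a = p"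
    "\<And>y. y \<in> V \<Longrightarrow> (\<psi> has_derivative blinfun_apply (\<psi>' y)) (at y)" "continuous_on V \<psi>'"
    "\<And>y. y \<in> V \<Longrightarrow> inj (blinfun_apply (\<psi>' y))"
    "\<And>y. \<lbrakk>y \<in> V; y \<in> L\<rbrakk> \<Longrightarrow> \<psi> y \<in> S \<and> tangent_space S (\<psi> y) = blinfun_apply (\<psi>' y) ` L"
proof -
  from S p obtain U V :: "'a set" and \<phi> \<psi> :: "'a \<Rightarrow> 'a" and L where
    U: "open U" and V: "open V" and pU: "p \<in> U" and hom: "homeomorphism U V \<phi> \<psi>"
    and C1: "C1_on U \<phi>" "C1_on V \<psi>" and L: "subspace L" "dim L = n" and slice: "\<phi> ` (S \<inter> U) = V \<inter> L"
    unfolding embedded_C1_submanifold_def by metis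
  obtain \<phi>' where \<phi>': "\<And>x. x \<in> U \<Longrightarrow> (\<phi> has_derivative blinfun_apply (\<phi>' x)) (at x)"
    using C1(1) unfolding C1_on_def by blast
  obtain \<psi>' where \<psi>': "\<And>y. y \<in> V \<Longrightarrow> (\<psi> has_derivative blinfun_apply (\<psi>' y)) (at y)"
    and cont: "continuous_on V \<psi>'"
    using C1(2) unfolding C1_on_def by blast
  have \<psi>U: "\<psi> y \<in> U" and \<phi>\<psi>: "\<phi> (\<psi> y) = y" if "y \<in> V" for y
    using hom that unfolding homeomorphism_def by blast+
  have \<phi>V: "\<phi> x \<in> V" and \<psi>\<phi>: "\<psi> (\<phi> x) = x" if "x \<in> U" for x
    using hom that unfolding homeomorphism_def by blast+
  have inv1: "\<phi>' (\<psi> y) (\<psi>' y w) = w" if y: "y \<in> V" for y w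
  proof -
    have "((\<lambda>x. \<phi> (\<psi> x)) has_derivative (\<lambda>w. \<phi>' (\<psi> y) (\<psi>' y w))) (at y)"
      by (rule has_derivative_compose[OF \<psi>'[OF y] \<phi>'[OF \<psi>U[OF y]]])
    moreover have "((\<lambda>x. \<phi> (\<psi> x)) has_derivative (\<lambda>w. w)) (at y)"
      using has_derivative_ident V y by (rule has_derivative_transform_within_open) (simp add: \<phi>\<psi>)
    ultimately show ?thesis
      by (metis has_derivative_unique)
  qed
  have inv2: "\<psi>' y (\<phi>' (\<psi> y) v) = v" if y: "y \<in> V" for y v
  proof -
    have d: "(\<psi> has_derivative \<psi>' y) (at (\<phi> (\<psi> y)))"
      using \<psi>' y \<phi>\<psi> by simp
    have "((\<lambda>x. \<psi> (\<phi> x)) has_derivative (\<lambda>w. \<psi>' y (\<phi>' (\<psi> y) w))) (at (\<psi> y))"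
      by (rule has_derivative_compose[OF \<phi>'[OF \<psi>U[OF y]] d])
    moreover have "((\<lambda>x. \<psi> (\<phi> x)) has_derivative (\<lambda>w. w)) (at (\<psi> y))"
      using has_derivative_ident U \<psi>U[OF y] by (rule has_derivative_transform_within_open) (simp add: \<psi>\<phi>)
    ultimately show ?thesis
      by (metis has_derivative_unique)
  qed
  have \<psi>S: "\<psi> y \<in> S" if "y \<in> V" "y \<in> L" for y
  proof -
    have "y \<in> \<phi> ` (S \<inter> U)"
      unfolding slice using that by (rule IntI)
    then obtain x where "x \<in> S \<inter> U" "y = \<phi> x"
      by (rule imageE)
    then show ?thesis
      using \<psi>\<phi> by simp
  qed
  have tangent: "tangent_space S (\<psi> y) = \<psi>' y ` L" if y: "y \<in> V" "y \<in> L" for y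
  proof (intro equalityI subsetI)
    fix v assume "v \<in> tangent_space S (\<psi> y)"
    then obtain \<gamma> \<epsilon> where \<epsilon>: "\<epsilon> > (0::real)" and \<gamma>S: "\<gamma> ` {-\<epsilon><..<\<epsilon>} \<subseteq> S" and \<gamma>0: "\<gamma> 0 = \<psi> y"
      and \<gamma>: "(\<gamma> has_vector_derivative v) (at 0)"
      unfolding tangent_space_def by blast
    have "isCont \<gamma> 0"
      using \<gamma> by (rule has_vector_derivative_continuous)
    then have "(\<gamma> \<longlongrightarrow> \<gamma> 0) (nhds 0)"
      by (simp only: continuous_at tendsto_at_iff_tendsto_nhds)
    then have "eventually (\<lambda>t. \<gamma> t \<in> U) (nhds 0)"
      using U by (rule topological_tendstoD) (simp add: \<gamma>0 \<psi>U y)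
    moreover have "eventually (\<lambda>t. t \<in> {-\<epsilon><..<\<epsilon>}) (nhds 0)"
      using \<epsilon> by (intro eventually_nhds_in_open) auto
    ultimately have "eventually (\<lambda>t. \<phi> (\<gamma> t) \<in> L) (nhds 0)"
    proof eventually_elim
      case (elim t)
      then have "\<gamma> t \<in> S \<inter> U"
        using \<gamma>S by blast
      then show ?case
        using slice by blast
    qed
    moreover have "((\<lambda>t. \<phi> (\<gamma> t)) has_vector_derivative \<phi>' (\<psi> y) v) (at 0)"
      using vector_derivative_diff_chain_within[OF \<gamma>, of \<phi> "\<phi>' (\<psi> y)"] \<phi>'[OF \<psi>U[OF y(1)]] \<gamma>0
      by (simp add: o_def has_derivative_at_withinI)
    ultimately have "\<phi>' (\<psi> y) v \<in> L"
      using vector_derivative_in_subspace[OF _ L(1)] by blast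
    then show "v \<in> \<psi>' y ` L"
      using inv2[OF y(1), of v] by (metis image_eqI)
  next
    fix v assume "v \<in> \<psi>' y ` L"
    then obtain w where w: "w \<in> L" "v = \<psi>' y w"
      by blast
    have "((\<lambda>t::real. y + t *\<^sub>R w) \<longlongrightarrow> y + 0 *\<^sub>R w) (nhds 0)"
      by (intro tendsto_intros) (rule filterlim_ident)
    moreover have "y + 0 *\<^sub>R w \<in> V"
      using y by simp
    ultimately have "eventually (\<lambda>t. y + t *\<^sub>R w \<in> V) (nhds 0)"
      by (rule topological_tendstoD[OF _ V])
    then obtain \<epsilon> where \<epsilon>: "\<epsilon> > 0" "\<And>t. dist t 0 < \<epsilon> \<Longrightarrow> y + t *\<^sub>R w \<in> V"
      unfolding eventually_nhds_metric by blast
    have inV: "y + t *\<^sub>R w \<in> V" if "t \<in> {-\<epsilon><..<\<epsilon>}" for t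
      using that by (intro \<epsilon>(2)) (auto simp: dist_real_def)
    let ?\<gamma> = "\<lambda>t. \<psi> (y + t *\<^sub>R w)"
    \<comment> \<open>\<open>C1_on\<close> asks for the derivative as a bounded linear function of
      the time increment; \<open>blinfun_scaleR_left w\<close> is that function for the
      line.\<close>
    have line: "((\<lambda>t. y + t *\<^sub>R w) has_derivative blinfun_apply (blinfun_scaleR_left w)) (at t)" for t
      by (auto intro!: derivative_eq_intros)
    have der: "(?\<gamma> has_derivative blinfun_apply (\<psi>' (y + t *\<^sub>R w) o\<^sub>L blinfun_scaleR_left w)) (at t)"
      if "t \<in> {-\<epsilon><..<\<epsilon>}" for t
      using has_derivative_compose[OF line \<psi>'[OF inV[OF that]]] by (simp add: blinfun_compose.rep_eq o_def)
    have "continuous_on {-\<epsilon><..<\<epsilon>} (\<lambda>t. \<psi>' (y + t *\<^sub>R w))"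
      by (rule continuous_on_compose2[OF cont]) (auto intro!: continuous_intros inV)
    then have "continuous_on {-\<epsilon><..<\<epsilon>} (\<lambda>t. \<psi>' (y + t *\<^sub>R w) o\<^sub>L blinfun_scaleR_left w)"
      by (intro continuous_intros)
    then have "C1_on {-\<epsilon><..<\<epsilon>} ?\<gamma>"
      unfolding C1_on_def
      by (intro exI[of _ "\<lambda>t. \<psi>' (y + t *\<^sub>R w) o\<^sub>L blinfun_scaleR_left w"] conjI ballI der)
    moreover have "?\<gamma> ` {-\<epsilon><..<\<epsilon>} \<subseteq> S"
    proof (rule image_subsetI)
      fix t assume t: "t \<in> {-\<epsilon><..<\<epsilon>}"
      have "y + t *\<^sub>R w \<in> L"
        using y(2) w(1) L(1) by (intro subspace_add subspace_scale)
      then show "\<psi> (y + t *\<^sub>R w) \<in> S"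
        by (rule \<psi>S[OF inV[OF t]])
    qed
    moreover have "(?\<gamma> has_vector_derivative v) (at 0)"
      using der[of 0] \<epsilon>(1) w(2) unfolding has_vector_derivative_def
      by (simp add: blinfun_compose.rep_eq o_def blinfun.scaleR_right)
    ultimately show "v \<in> tangent_space S (\<psi> y)"
      unfolding tangent_space_def using \<epsilon>(1) by force
  qed
  have "inj (blinfun_apply (\<psi>' y))" if "y \<in> V" for y
    using inv1[OF that] by (metis injI)
  moreover have "\<phi> p \<in> \<phi> ` (S \<inter> U)"
    using p pU by simp
  then have "\<phi> p \<in> V" "\<phi> p \<in> L"
    unfolding slice by simp_all
  ultimately show ?thesis
    using V L \<psi>\<phi>[OF pU] \<psi>' cont \<psi>S tangent by (intro that[of V "\<phi> p" L \<psi> \<psi>']) simp_all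
qed

text \<open>Near \<open>x\<close> the factor \<open>c\<close> is of the order of the distance, while
  \<open>d z - d x\<close> tends to 0. Replacing \<open>d z\<close> by \<open>d x\<close> therefore
  changes the product by an error of higher than first order.\<close>

lemma has_derivative_vanishing_mult_continuous:
  fixes c :: "'a::real_normed_vector \<Rightarrow> 'b::real_normed_vector"
    and d :: "'a \<Rightarrow> 'c::real_normed_vector" and prod :: "'b \<Rightarrow> 'c \<Rightarrow> 'd::real_normed_vector"
  assumes prod: "bounded_bilinear prod"
    and c: "(c has_derivative c') (at x)" "c x = 0" and d: "isCont d x"
  shows "((\<lambda>z. prod (c z) (d z)) has_derivative (\<lambda>h. prod (c' h) (d x))) (at x)"
proof -
  interpret bounded_bilinear prod
    by (rule prod)
  obtain B where B: "B > 0" "\<And>u v. norm (prod u v) \<le> norm u * norm v * B"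
    using pos_bounded by blast
  obtain K where K: "K > 0" "\<And>h. norm (c' h) \<le> norm h * K"
    using has_derivative_bounded_linear[OF c(1)] bounded_linear.pos_bounded by blast
  have "((\<lambda>z. prod (c z) (d z - d x)) has_derivative (\<lambda>h. 0)) (at x)"
    unfolding has_derivative_at_alt
  proof (intro conjI allI impI bounded_linear_zero)
    fix \<epsilon> :: real assume "\<epsilon> > 0"
    obtain \<delta>1 where \<delta>1: "\<delta>1 > 0" "\<And>z. norm (z - x) < \<delta>1 \<Longrightarrow> norm (c z - c x - c' (z - x)) \<le> 1 * norm (z - x)"
      using c(1)[unfolded has_derivative_at_alt, THEN conjunct2, rule_format, of 1] by auto
    \<comment> \<open>\<open>K\<close> bounds the linear part of \<open>c\<close>, and the 1 bounds
      its remainder, estimated with tolerance 1.\<close>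
    define C where "C = K + 1"
    have C: "C > 0"
      using K(1) by (simp add: C_def)
    have "\<epsilon> / (B * C) > 0"
      using \<open>\<epsilon> > 0\<close> B(1) C by simp
    then obtain \<delta>2 where \<delta>2: "\<delta>2 > 0" "\<And>z. norm (z - x) < \<delta>2 \<Longrightarrow> norm (d z - d x) < \<epsilon> / (B * C)"
      using d unfolding continuous_at_eps_delta dist_norm by blast
    have "norm (prod (c z) (d z - d x)) \<le> \<epsilon> * norm (z - x)" if z: "norm (z - x) < min \<delta>1 \<delta>2" for z
    proof -
      have "norm (c z) \<le> norm (c z - c' (z - x)) + norm (c' (z - x))"
        by (metis diff_add_cancel norm_triangle_ineq)
      also have "\<dots> \<le> norm (z - x) + norm (z - x) * K"
        using \<delta>1(2)[of z] z K(2)[of "z - x"] c(2) by simp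
      finally have 1: "norm (c z) \<le> C * norm (z - x)"
        by (simp add: C_def algebra_simps)
      have 2: "norm (d z - d x) \<le> \<epsilon> / (B * C)"
        using \<delta>2(2)[of z] z by simp
      have "norm (prod (c z) (d z - d x)) \<le> norm (c z) * norm (d z - d x) * B"
        by (rule B(2))
      also have "\<dots> \<le> (C * norm (z - x)) * (\<epsilon> / (B * C)) * B"
        using 1 2 B(1) C by (intro mult_right_mono mult_mono) auto
      also have "\<dots> = \<epsilon> * norm (z - x)"
        using B(1) C by (simp add: field_simps)
      finally show ?thesis .
    qed
    then show "\<exists>\<delta>>0. \<forall>z. norm (z - x) < \<delta> \<longrightarrow>
        norm (prod (c z) (d z - d x) - prod (c x) (d x - d x) - 0) \<le> \<epsilon> * norm (z - x)"
      using \<delta>1(1) \<delta>2(1) c(2) zero_left by (intro exI[of _ "min \<delta>1 \<delta>2"]) auto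
  qed
  moreover have "((\<lambda>z. prod (c z) (d x)) has_derivative (\<lambda>h. prod (c' h) (d x))) (at x)"
    by (rule bounded_linear.has_derivative[OF bounded_linear_left c(1)])
  ultimately have "((\<lambda>z. prod (c z) (d z - d x) + prod (c z) (d x)) has_derivative
      (\<lambda>h. 0 + prod (c' h) (d x))) (at x)"
    by (rule has_derivative_add)
  then show ?thesis
    by (simp add: diff_right)
qed

section \<open>Horizontal tangent spaces are commutative\<close>

context homogeneous_group
begin

text \<open>Since \<open>br X Y\<close> lies in \<open>H 2\<close>, it suffices to pair it with each
  \<open>b\<close> there, which leaves real functions of two parameters. Horizontality enters at all
  points of \<open>S\<close> near \<open>p\<close>, because the resulting equation is
  differentiated.\<close>

lemma horizontal_tangent_vectors_commute:
  assumes S: "embedded_C1_submanifold n S" and p: "p \<in> S"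
    and hor: "\<And>q. q \<in> S \<Longrightarrow> tangent_space S q \<subseteq> horizontal_fiber q"
    and X: "X \<in> H 1" "left_deriv p X \<in> tangent_space S p"
    and Y: "Y \<in> H 1" "left_deriv p Y \<in> tangent_space S p"
  shows "br X Y = 0"
proof -
  obtain V :: "'a set" and \<psi> :: "'a \<Rightarrow> 'a" and \<psi>' L a where
    V: "open V" "a \<in> V" and L: "a \<in> L" "subspace L" and \<psi>a: "\<psi> a = p"
    and \<psi>': "\<And>y. y \<in> V \<Longrightarrow> (\<psi> has_derivative blinfun_apply (\<psi>' y)) (at y)"
    and cont: "continuous_on V \<psi>'"
    and \<psi>S: "\<And>y. \<lbrakk>y \<in> V; y \<in> L\<rbrakk> \<Longrightarrow> \<psi> y \<in> S \<and> tangent_space S (\<psi> y) = blinfun_apply (\<psi>' y) ` L"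
    by (rule embedded_C1_submanifold_parametrization[OF S p]) (rule that)
  obtain P where P: "linear P" "\<And>x. P x \<in> H 1" "\<And>x. x - P x \<in> filtration 2"
    "\<And>x. x \<in> H 1 \<Longrightarrow> P x = x" "\<And>x. x \<in> filtration 2 \<Longrightarrow> P x = 0"
    by (rule horizontal_projection) (rule that)
  have P_left_deriv: "P (left_deriv q h) = h" if "h \<in> H 1" for q h
  proof -
    have "left_deriv q h - h \<in> filtration 2"
      using left_deriv_filtration[of 1 h q] filtration_one by (simp add: numeral_2_eq_2)
    then have "P (left_deriv q h) - P h = 0"
      using P(5) by (simp flip: linear_diff[OF P(1)])
    then show ?thesis
      using P(4)[OF that] by simp
  qed
  obtain u w where u: "u \<in> L" "\<psi>' a u = left_deriv p X" and w: "w \<in> L" "\<psi>' a w = left_deriv p Y"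
    using X(2) Y(2) \<psi>S[OF V(2) L(1)] \<psi>a by auto
  have "br X Y \<bullet> b = 0" if b: "b \<in> H 2" for b
  proof -
    \<comment> \<open>With \<open>P\<close> in both slots the contact equation involves only
      \<open>\<psi>\<close> and its derivative: \<open>P\<close> recovers \<open>h\<close> from
      \<open>left_deriv (\<psi> y) h\<close>, and replacing \<open>\<psi> y\<close> by its first
      layer component costs a bracket in \<open>filtration 3\<close>, which is orthogonal to
      \<open>b\<close>.\<close>
    define \<beta> where "\<beta> x y = (1 / 2) * (br (P x) (P y) \<bullet> b)" for x y
    have \<beta>_bilinear: "bilinear \<beta>"
      unfolding bilinear_def \<beta>_def
      by (intro conjI allI linearI)
         (simp_all add: linear_add[OF P(1)] linear_scale[OF P(1)] linear_add[OF linear_br_left]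
          linear_add[OF linear_br_right] linear_scale[OF linear_br_left] linear_scale[OF linear_br_right]
          inner_add_left distrib_left)
    then have \<beta>: "bounded_bilinear \<beta>"
      by (rule bilinear_conv_bounded_bilinear[THEN iffD1])
    have vanish: "x \<bullet> b = 0" if "x \<in> filtration 3" for x
      using layer_orthogonal_filtration[of 2 3 b x] b that by (simp add: inner_commute)
    have contact: "\<psi>' y z \<bullet> b = \<beta> (\<psi> y) (\<psi>' y z)" if y: "y \<in> V" "y \<in> L" and z: "z \<in> L" for y z
    proof -
      have "\<psi>' y z \<in> horizontal_fiber (\<psi> y)"
        using \<psi>S[OF y] hor[of "\<psi> y"] z by blast
      then obtain Z where "Z \<in> Lie" "Z 0 \<in> H 1" "\<psi>' y z = Z (\<psi> y)"
        unfolding horizontal_fiber_def by blast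
      then obtain h where h: "h \<in> H 1" "\<psi>' y z = left_deriv (\<psi> y) h"
        using Lie_eq_left_deriv[of Z "\<psi> y"] by metis
      have "h \<bullet> b = 0"
        using layers_orthogonal[of 1 2 h b] h b by simp
      moreover have "(left_deriv (\<psi> y) h - (h + (1 / 2) *\<^sub>R br (\<psi> y) h)) \<bullet> b = 0"
        by (intro vanish left_deriv_second_order)
      ultimately have 1: "\<psi>' y z \<bullet> b = (1 / 2) * (br (\<psi> y) h \<bullet> b)"
        by (simp add: h(2) inner_diff_left inner_add_left)
      have "br (\<psi> y - P (\<psi> y)) h \<in> filtration (2 + 1)"
        by (rule br_filtration) (use P(3) filtration_one in auto)
      then have "br (\<psi> y - P (\<psi> y)) h \<bullet> b = 0"
        by (intro vanish) simp
      then have "br (\<psi> y) h \<bullet> b = br (P (\<psi> y)) h \<bullet> b"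
        by (simp add: linear_diff[OF linear_br_left] inner_diff_left)
      then show ?thesis
        using 1 P_left_deriv[OF h(1)] by (simp add: \<beta>_def h(2))
    qed
    \<comment> \<open>\<open>u\<close> and \<open>w\<close> are the parameter directions of the
      tangent vectors belonging to \<open>X\<close> and \<open>Y\<close>; the plane lies in
      \<open>L\<close>, so the contact equation holds along it.\<close>
    define y where "y s t = a + s *\<^sub>R u + t *\<^sub>R w" for s t :: real
    \<comment> \<open>As \<open>\<psi>\<close> is only \<open>C\<^sup>1\<close>, the derivative \<open>\<beta> (\<psi> y) (\<psi>' y z)\<close> of \<open>\<psi> y \<bullet> b\<close> need not be differentiable.
      Subtracting \<open>\<beta> p (\<psi> y)\<close> replaces its first factor by \<open>\<psi> y - p\<close>, which vanishes at \<open>a\<close>; there the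
      product with a continuous factor is differentiable.\<close>
    define k where "k s t = \<psi> (y s t) \<bullet> b - \<beta> p (\<psi> (y s t))" for s t
    have yL: "y s t \<in> L" for s t
      unfolding y_def using L u w by (intro subspace_add subspace_scale)
    obtain r where r: "r > 0" "ball a r \<subseteq> V"
      using V openE by blast
    \<comment> \<open>Keeps \<open>s *\<^sub>R u + t *\<^sub>R w\<close> shorter than
      \<open>r\<close>; the 1 keeps the denominator positive even when \<open>u\<close> and
      \<open>w\<close> vanish.\<close>
    define r' where "r' = r / (norm u + norm w + 1)"
    have r': "r' > 0"
      unfolding r'_def using r(1) by (intro divide_pos_pos add_nonneg_pos) auto
    have yV: "y s t \<in> V" if "\<bar>s\<bar> < r'" "\<bar>t\<bar> < r'" for s t
    proof -
      have "norm (s *\<^sub>R u + t *\<^sub>R w) \<le> \<bar>s\<bar> * norm u + \<bar>t\<bar> * norm w"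
        using norm_triangle_ineq[of "s *\<^sub>R u" "t *\<^sub>R w"] by simp
      also have "\<dots> \<le> r' * norm u + r' * norm w"
        using that by (intro add_mono mult_right_mono) auto
      also have "\<dots> < r' * (norm u + norm w + 1)"
        using r' by (simp add: algebra_simps)
      also have "\<dots> = r"
      proof -
        have "norm u + norm w + 1 \<noteq> 0"
          by (smt (verit) norm_ge_zero)
        then show ?thesis
          by (simp add: r'_def)
      qed
      finally have "norm (y s t - a) < r"
        by (simp add: y_def add.assoc)
      then have "y s t \<in> ball a r"
        by (simp only: mem_ball dist_norm norm_minus_commute)
      then show ?thesis
        using r(2) by blast
    qed
    have deriv: "((\<lambda>\<tau>. \<psi> (l \<tau>) \<bullet> b - \<beta> p (\<psi> (l \<tau>))) has_real_derivative
        \<beta> (\<psi> (l \<tau>) - \<psi> a) (\<psi>' (l \<tau>) z)) (at \<tau>)"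
      if l: "(l has_vector_derivative z) (at \<tau>)" "l \<tau> \<in> V" "l \<tau> \<in> L" "z \<in> L" for l z \<tau>
    proof -
      have "((\<lambda>\<tau>. \<psi> (l \<tau>)) has_vector_derivative \<psi>' (l \<tau>) z) (at \<tau>)"
        using vector_derivative_diff_chain_within[OF l(1), of \<psi> "\<psi>' (l \<tau>)"] \<psi>'[OF l(2)]
        by (simp add: o_def has_derivative_at_withinI)
      then have "((\<lambda>\<tau>. \<psi> (l \<tau>) \<bullet> b - \<beta> p (\<psi> (l \<tau>))) has_vector_derivative
          \<psi>' (l \<tau>) z \<bullet> b - \<beta> p (\<psi>' (l \<tau>) z)) (at \<tau>)"
        by (intro has_vector_derivative_diff bounded_linear.has_vector_derivative[OF bounded_linear_inner_left]
            bounded_linear.has_vector_derivative[OF bounded_bilinear.bounded_linear_right[OF \<beta>]])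
      then show ?thesis
        using contact[OF l(2-4)] \<psi>a
        by (simp add: has_real_derivative_iff_has_vector_derivative bounded_bilinear.diff_left[OF \<beta>])
    qed
    have derp: "((\<lambda>s. k s t) has_real_derivative \<beta> (\<psi> (y s t) - \<psi> a) (\<psi>' (y s t) u)) (at s)"
      if "\<bar>s\<bar> < r'" "\<bar>t\<bar> < r'" for s t
      unfolding k_def
    proof (rule deriv[where l = "\<lambda>s. y s t", OF _ yV[OF that] yL u(1)])
      show "((\<lambda>s. y s t) has_vector_derivative u) (at s)"
        unfolding y_def by (auto intro!: derivative_eq_intros)
    qed
    have derq: "((\<lambda>t. k s t) has_real_derivative \<beta> (\<psi> (y s t) - \<psi> a) (\<psi>' (y s t) w)) (at t)"
      if "\<bar>s\<bar> < r'" "\<bar>t\<bar> < r'" for s t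
      unfolding k_def
    proof (rule deriv[where l = "y s", OF _ yV[OF that] yL w(1)])
      show "(y s has_vector_derivative w) (at t)"
        unfolding y_def by (auto intro!: derivative_eq_intros)
    qed
    let ?y = "\<lambda>z. y (fst z) (snd z)"
    have y0: "?y (0, 0) = a"
      by (simp add: y_def)
    have y': "(?y has_derivative (\<lambda>h. fst h *\<^sub>R u + snd h *\<^sub>R w)) (at (0, 0))"
      unfolding y_def by (auto intro!: derivative_eq_intros)
    have c: "((\<lambda>z. \<psi> (?y z) - \<psi> a) has_derivative (\<lambda>h. \<psi>' a (fst h *\<^sub>R u + snd h *\<^sub>R w))) (at (0, 0))"
    proof -
      have "(\<psi> has_derivative \<psi>' a) (at (?y (0, 0)))"
        unfolding y0 by (rule \<psi>'[OF V(2)])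
      from has_derivative_diff[OF has_derivative_compose[OF y' this] has_derivative_const[of "\<psi> a"]]
      show ?thesis
        by simp
    qed
    have d: "isCont (\<lambda>z. \<psi>' (?y z) v) (0, 0)" for v
    proof -
      have "isCont \<psi>' (?y (0, 0))"
        unfolding y0 using cont V by (simp add: continuous_on_eq_continuous_at)
      moreover have "isCont ?y (0, 0)"
        using y' by (rule has_derivative_continuous)
      ultimately have "isCont (\<lambda>z. \<psi>' (?y z)) (0, 0)"
        by (rule isCont_o2[rotated])
      then show ?thesis
        by (intro continuous_intros)
    qed
    have second: "((\<lambda>z. \<beta> (\<psi> (?y z) - \<psi> a) (\<psi>' (?y z) v)) has_derivative
        (\<lambda>h. \<beta> (\<psi>' a (fst h *\<^sub>R u + snd h *\<^sub>R w)) (\<psi>' a v))) (at (0, 0))" for v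
      using has_derivative_vanishing_mult_continuous[OF \<beta> c _ d[of v]] by (simp add: y0 y_def)
    \<comment> \<open>The two sides are the halves of \<open>br Y X \<bullet> b\<close> and
      \<open>br X Y \<bullet> b\<close>. They are equal by symmetry of the mixed derivatives and
      opposite by antisymmetry of the bracket.\<close>
    have "\<beta> (\<psi>' a w) (\<psi>' a u) = \<beta> (\<psi>' a u) (\<psi>' a w)"
      using mixed_partials_commute[OF r' derp derq second second] by simp
    then have "br Y X \<bullet> b = br X Y \<bullet> b"
      using P_left_deriv[OF X(1)] P_left_deriv[OF Y(1)] by (simp add: \<beta>_def u w)
    then show ?thesis
      using br_anticommute[of Y X] by simp
  qed
  moreover have "br X Y \<in> H 2"
    using br_layers[of 1 1 X Y] X Y by (simp add: numeral_2_eq_2)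
  ultimately show ?thesis
    using inner_eq_zero_iff by blast
qed

end

section \<open>Horizontal points\<close>

context graded_basis
begin

lemma deg_layer_one:
  assumes "i \<in> {1..m 1}"
  shows "deg i = 1"
  unfolding deg_def
proof (rule the_equality)
  show "m (1 - 1) < i \<and> i \<le> m 1"
    using assms by (simp add: m_def)
  fix j assume j: "m (j - 1) < i \<and> i \<le> m j"
  have mono: "m 1 \<le> m k" if "1 \<le> k" for k
    unfolding m_def using that by (intro sum_mono2) auto
  show "j = 1"
  proof (rule ccontr)
    assume "j \<noteq> 1"
    \<comment> \<open>At \<open>j = 0\<close> truncated subtraction turns the condition into the
      contradictory \<open>m 0 < i \<and> i \<le> m 0\<close>.\<close>
    moreover have "j \<noteq> 0"
      using j by (cases j) auto
    ultimately have "m 1 \<le> m (j - 1)"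
      by (intro mono) auto
    then show False
      using j assms by simp
  qed
qed

lemma horizontal_coordinates:
  assumes "v \<in> H 1" "i \<in> {1..DIM('a)}" "v \<bullet> e i \<noteq> 0"
  shows "i \<in> {1..m 1}"
proof (rule ccontr)
  assume i: "i \<notin> {1..m 1}"
  have "m 1 = dim (H 1)"
    by (simp add: m_def)
  \<comment> \<open>Orthonormality of \<open>e\<close> is available only for indices up to
    \<open>DIM('a)\<close>.\<close>
  then have m1: "m 1 \<le> DIM('a)"
    using dim_subset_UNIV[of "H 1"] by simp
  have "v \<in> span (e ` {1..m 1})"
    using assms(1) e_layer[of 1] step_pos by (simp add: m_def atLeastSucAtMost_greaterThanAtMost)
  then have "orthogonal (e i) v"
  proof (rule orthogonal_to_span)
    fix x assume "x \<in> e ` {1..m 1}"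
    then show "orthogonal (e i) x"
      using i assms(2) m1 by (auto simp: orthogonal_def e_orthonormal)
  qed
  then show False
    using assms(3) by (simp add: orthogonal_def inner_commute)
qed

lemma horizontal_point_if_horizontal_tangent:
  assumes S: "embedded_C1_submanifold n S" and p: "p \<in> S"
    and hor: "\<And>q. q \<in> S \<Longrightarrow> tangent_space S q \<subseteq> horizontal_fiber q"
  shows "horizontal_point n S p"
proof -
  let ?F = "left_deriv p"
  have F: "linear ?F" "inj ?F"
    using linear_left_deriv left_deriv_inject by (auto intro: injI)
  obtain G where G: "linear G" "\<And>v. G (?F v) = v"
    using linear_injective_left_inverse[OF F] by (metis comp_apply id_apply)
  have lift: "\<exists>X\<in>Lie. X 0 \<in> H 1 \<and> X 0 = G t \<and> ?F (G t) = t" if "t \<in> tangent_space S p" for t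
  proof -
    have "t \<in> horizontal_fiber p"
      using hor[OF p] that by blast
    then obtain X where X: "X \<in> Lie" "X 0 \<in> H 1" "t = X p"
      unfolding horizontal_fiber_def by blast
    then have "t = ?F (X 0)"
      using Lie_eq_left_deriv by metis
    then show ?thesis
      using X G(2) by metis
  qed
  \<comment> \<open>\<open>tangent_space\<close> is defined through velocities of curves; the
    parametrization shows that it is a subspace and that its dimension is \<open>n\<close>.\<close>
  obtain V :: "'a set" and \<psi> :: "'a \<Rightarrow> 'a" and \<psi>' L a where
    chart: "open V" "a \<in> V" "a \<in> L" "subspace L" "dim L = n" "\<psi> a = p"
    "\<And>y. y \<in> V \<Longrightarrow> (\<psi> has_derivative blinfun_apply (\<psi>' y)) (at y)" "continuous_on V \<psi>'"
    "\<And>y. y \<in> V \<Longrightarrow> inj (blinfun_apply (\<psi>' y))"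
    "\<And>y. \<lbrakk>y \<in> V; y \<in> L\<rbrakk> \<Longrightarrow> \<psi> y \<in> S \<and> tangent_space S (\<psi> y) = blinfun_apply (\<psi>' y) ` L"
    by (rule embedded_C1_submanifold_parametrization[OF S p]) (rule that)
  have T: "tangent_space S p = \<psi>' a ` L"
    using chart by blast
  have lin: "linear (\<psi>' a)"
    by (rule bounded_linear.linear) (rule blinfun.bounded_linear_right)
  have T_sub: "subspace (tangent_space S p)"
    unfolding T using lin chart(4) by (rule linear_subspace_image)
  have T_dim: "dim (tangent_space S p) = n"
    unfolding T using dim_image_eq[OF lin] chart(2,5,9) inj_on_subset by (metis subset_UNIV)
  define Vp where "Vp = G ` tangent_space S p"
  have Vp_sub: "subspace Vp"
    unfolding Vp_def using G(1) T_sub by (rule linear_subspace_image)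
  have Vp_H1: "Vp \<subseteq> H 1"
    using lift unfolding Vp_def by force
  have Vp_F: "?F v \<in> tangent_space S p" if "v \<in> Vp" for v
    using that lift unfolding Vp_def by force
  have Vp_commute: "br v w = 0" if "v \<in> Vp" "w \<in> Vp" for v w
    using horizontal_tangent_vectors_commute[OF S p hor, of v w] Vp_H1 Vp_F that by blast

  let ?is_tangent = "\<lambda>\<xi>. \<xi> \<in> left_inv_mv n \<and>
        (\<exists>ts. length ts = n \<and> distinct ts \<and> independent (set ts) \<and>
              span (set ts) = tangent_space S p \<and> mv_field \<xi> p = wedge_vecs ts)"
  have field: "mv_field c x = mv_map (left_deriv x) c" for c x
    by (simp add: mv_field_eq_mv_map left_deriv_def)
  have "?is_tangent (tangent_mv n S p)"
    unfolding tangent_mv_def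
  proof (rule someI_ex[of ?is_tangent])
    \<comment> \<open>The choice in \<open>tangent_mv\<close> is meaningful only if a candidate
      exists: a basis of the tangent space, moved to the identity by \<open>G\<close>, is multiplied
      out to give one.\<close>
    obtain B where B: "B \<subseteq> tangent_space S p" "independent B" "span B = tangent_space S p" "card B = n"
      using basis_exists[of "tangent_space S p"] T_sub T_dim span_subspace by metis
    obtain ts where ts: "set ts = B" "distinct ts"
      using finite_distinct_list[OF finiteI_independent[OF B(2)]] by blast
    have len: "length ts = n"
      using distinct_card[OF ts(2)] ts(1) B(4) by simp
    have "map ?F (map G ts) = ts"
    proof -
      have "?F (G t) = t" if "t \<in> set ts" for t
        using lift[of t] B(1) ts(1) that by blast
      then show ?thesis
        by (simp add: map_idI)
    qed
    then have "mv_field (wedge_vecs (map G ts)) p = wedge_vecs ts"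
      by (simp only: field mv_map_wedge_vecs[OF F(1)])
    moreover have "wedge_vecs (map G ts) \<in> left_inv_mv n"
      using wedge_vecs_coeff[of "map G ts" UNIV] len by (auto simp: left_inv_mv_def)
    ultimately show "\<exists>\<xi>. ?is_tangent \<xi>"
      using B ts len by blast
  qed
  then obtain ts where \<xi>: "tangent_mv n S p \<in> left_inv_mv n"
    and ts: "length ts = n" "distinct ts" "independent (set ts)" "span (set ts) = tangent_space S p"
    and field_ts: "mv_map ?F (tangent_mv n S p) = wedge_vecs ts"
    unfolding field by blast
  define vs where "vs = map G ts"
  \<comment> \<open>Whichever candidate was chosen, the map induced by \<open>G\<close> undoes
    evaluation at \<open>p\<close>, so its coefficients are those of the product of the vectors
    \<open>G t\<close>.\<close>
  have \<xi>_vs: "tangent_mv n S p = wedge_vecs vs"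
  proof -
    have "tangent_mv n S p = mv_map G (mv_map ?F (tangent_mv n S p))"
      by (rule mv_map_inverse[OF F(1) G, symmetric]) (use \<xi> in \<open>auto simp: left_inv_mv_def\<close>)
    then show ?thesis
      by (simp only: field_ts mv_map_wedge_vecs[OF G(1)] vs_def)
  qed
  have span_vs: "span (set vs) = Vp"
    by (simp add: vs_def Vp_def linear_span_image[OF G(1)] ts(4))
  have inj_G: "inj_on G (tangent_space S p)"
    using lift by (metis inj_onI)
  have vs: "distinct vs" "independent (set vs)"
  proof -
    have "set ts \<subseteq> tangent_space S p"
      using span_superset ts(4) by blast
    then show "distinct vs"
      unfolding vs_def using ts(2) inj_G by (simp add: distinct_map inj_on_subset)
    show "independent (set vs)"
      unfolding vs_def using linear_independent_injective_image[OF G(1) ts(3)] inj_G ts(4) by simp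
  qed
  \<comment> \<open>All factors lie in the first layer, where each index has degree 1, so the degree
    counts the factors.\<close>
  have degree: "deg_set I = n" if "wedge_vecs vs I \<noteq> 0" for I
  proof -
    have "I \<subseteq> {1..DIM('a)} \<inter> {1..m 1} \<and> card I = length vs"
    proof (rule wedge_vecs_coeff[OF _ that])
      fix v i assume "v \<in> set vs" "i \<in> {1..DIM('a)}" "v \<bullet> e i \<noteq> 0"
      moreover have "set vs \<subseteq> H 1"
        using span_superset span_vs Vp_H1 by blast
      ultimately show "i \<in> {1..m 1}"
        using horizontal_coordinates by blast
    qed
    moreover from this have "deg_set I = (\<Sum>i\<in>I. 1)"
      unfolding deg_set_def using deg_layer_one by (intro sum.cong) auto
    ultimately show ?thesis
      using ts(1) by (simp add: vs_def)
  qed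
  have proj: "mv_proj M (wedge_vecs vs) = (if M = n then wedge_vecs vs else (\<lambda>I. 0))" for M
    using degree by (auto simp: mv_proj_def fun_eq_iff)
  have "{M. mv_proj M (wedge_vecs vs) \<noteq> (\<lambda>I. 0)} = {n}"
    using wedge_vecs_nonzero[OF vs] by (auto simp: proj)
  then have pdeg: "point_degree n S p = n"
    by (simp add: point_degree_def \<xi>_vs)
  \<comment> \<open>The condition at \<open>x\<close> is the image, under the map induced by
    \<open>left_deriv x\<close>, of the condition at 0. The one at 0 thus implies all others, and it
    is itself among them because \<open>left_deriv 0\<close> is the identity.\<close>
  have alg: "tangent_algebra n S p = {X \<in> Lie. X 0 \<in> Vp}"
  proof -
    have "(\<forall>x. wedge (mv_vec (X x)) (mv_map (left_deriv x) (wedge_vecs vs)) = (\<lambda>I. 0)) \<longleftrightarrow> X 0 \<in> Vp"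
      if X: "X \<in> Lie" for X
    proof -
      have "wedge (mv_vec (X x)) (mv_map (left_deriv x) (wedge_vecs vs))
          = mv_map (left_deriv x) (wedge (mv_vec (X 0)) (wedge_vecs vs))" for x
        using Lie_eq_left_deriv[OF X, of x] by (simp add: mv_map_wedge[OF linear_left_deriv])
      moreover have "mv_map (left_deriv 0) (wedge_vecs vs) = wedge_vecs vs"
        by (simp add: mv_map_wedge_vecs[OF linear_left_deriv] left_deriv_0 map_idI)
      ultimately show ?thesis
        using wedge_vecs_eq_0_iff[OF vs, of "X 0"] span_vs mv_map_zero by metis
    qed
    then show ?thesis
      by (auto simp: tangent_algebra_def pdeg \<xi>_vs proj field)
  qed
  have Lie_Vp: "\<exists>X\<in>Lie. X 0 = v" if "v \<in> Vp" for v
    using lift that unfolding Vp_def by force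
  have "lie_subalgebra (tangent_algebra n S p)"
    unfolding lie_subalgebra_def alg
    using Lie_zero Lie_add Lie_scale vf_bracket_commuting Vp_commute
      subspace_0[OF Vp_sub] subspace_add[OF Vp_sub] subspace_scale[OF Vp_sub] by auto
  moreover have "tangent_set n S p = Vp"
    using Lie_Vp by (auto simp: tangent_set_def alg lie_exp_def)
  moreover have "is_subgroup Vp"
    unfolding is_subgroup_def
    using mult_commuting Vp_commute subspace_0[OF Vp_sub] subspace_add[OF Vp_sub] subspace_neg[OF Vp_sub]
    by auto
  ultimately show ?thesis
    unfolding horizontal_point_def algebraically_regular_def horizontal_subgroup_def
    using Vp_sub Vp_H1 by simp
qed

end

theorem theorem4p7:
  fixes H :: "nat \<Rightarrow> 'a::euclidean_space set"
    and \<iota> n :: nat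
    and br :: "'a \<Rightarrow> 'a \<Rightarrow> 'a"
    and e :: "nat \<Rightarrow> 'a"
    and S :: "'a set"
  assumes "graded_basis H \<iota> br e"
    and "embedded_C1_submanifold n S"
    and "\<And>p. p \<in> S \<Longrightarrow> tangent_space S p \<subseteq> homogeneous_group.horizontal_fiber H \<iota> br p"
  shows "graded_basis.horizontal_submanifold H \<iota> br e n S"
proof -
  interpret graded_basis H \<iota> br e
    by (rule assms(1))
  show ?thesis
    unfolding horizontal_submanifold_def
    using horizontal_point_if_horizontal_tangent[OF assms(2)] assms(3) by blast
qed

end
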